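(* Let $\mathcal Q(C_a,C_b)$ be an HGP code of length $n$ (taken from a sequence of HGP codes satisfying the scaling assumptions in the context, and with logical Pauli operators given by SLT bases). (a) For any two distinct logical qubits $(i_1,h_1,L)$ and $(i_2,h_2,L)$ in the same sector there exists a Clifford circuit $\mathsf C$ that implements the targeted logical gate $\overline{CZ}_{(i_1,h_1,L)\leftrightarrow(i_2,h_2,L)}$. (b) For any two logical qubits $(i,h,L)$ and $(j,l,R)$ in different sectors there exists a Clifford circuit $\mathsf C$ that implements the targeted logical gate $\overline{CZ}_{(i,h,L)\leftrightarrow(j,l,R)}$. In both cases the support size $\chi(\mathsf C)$ and the depth $\delta(\mathsf C)$ are of order $\Theta(\sqrt n)$.
   Context: All vectors are row vectors over $\mathbb F_2$; $e_i$ denotes a standard basis vector. Given binary matrices $H_a$ ($m_a\times n_a$), $H_b$ ($m_b\times n_b$), parity-check matrices of classical codes $C_a=\ker H_a$, $C_b=\ker H_b$, the hypergraph product (HGP) code $\mathcal Q(C_a,C_b)$ is the CSS code on $n=n_an_b+m_am_b$ qubits with $$H_X=[H_a\otimes I_{n_b}\,|\,I_{m_a}\otimes H_b^{\top}],\qquad H_Z=[I_{n_a}\otimes H_b\,|\,H_a^{\top}\otimes I_{m_b}].$$ Its stabilizer generators are the $X$-type Pauli operators supported on the rows of $H_X$ and the $Z$-type Pauli operators supported on the rows of $H_Z$. The first $n_an_b$ qubits form the left sector and the remaining ones the right sector. An SLT basis of a subspace is a basis $\{a_i\}$ indexed by distinct coordinates $i$ (pivots) such that $(a_i)_i=1$ and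 $(a_{i'})_i=0$ for pivots $i'\ne i$. Let $\{a_i\},\{\alpha_j\},\{b_h\},\{\beta_l\}$ be SLT bases of $\ker H_a,\ker H_a^{\top},\ker H_b,\ker H_b^{\top}$. Logical qubits are labelled $(i,h,L)$ ($i,h$ pivots of $\{a_i\},\{b_h\}$) and $(j,l,R)$ ($j,l$ pivots of $\{\alpha_j\},\{\beta_l\}$). Logical Paulis: $\overline X_{i,h,L}$ is the $X$-type operator with support vector $[e_i\otimes b_h|0]$, $\overline Z_{i,h,L}$ the $Z$-type operator with $[a_i\otimes e_h|0]$, $\overline X_{j,l,R}$ the $X$-type operator with $[0|\alpha_j\otimes e_l]$, $\overline Z_{j,l,R}$ the $Z$-type operator with $[0|e_j\otimes\beta_l]$. Scaling assumptions: a sequence of HGP codes with $n\to\infty$, where $n_a,n_b$ scale in proportion to $\sqrt n$ and the dimensions and distances of the constituent codes are a constant proportion of their lengths, so that the Hamming weights of all vectors in the four SLT bases are $\Theta(\sqrt n)$ (uniformly). A Clifford circuit $\mathsf C$ is a finite sequence of one- and two-qubit gates on the $n$ physical qubits from $\{H,S,CNOT,CZ,SWAP\}$ and single-qubit Paulis (no ancillas), enacting a unitary $U$. Its support is the smallest set of qubits such that $U$ acts as the identity on every qubit outside it, with size $\chi(\mathsf C)$; its depth $\delta(\mathsf C)$ is the minimum number of layers into which its gates can be arranged so that gates in the same layer do not overlap on qubits. $\mathsf C$ implements a logical gate $g$ if $USU^\dagger=S$ for every stabilizer generator $S$ and conjugation by $U$ acts on the logical Paulis as $g$ prescribes, up to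 global phases of logical Paulis. The gate $\overline{CZ}_{p\leftrightarrow q}$ maps $\overline X_p\mapsto\overline X_p\overline Z_q$, $\overline X_q\mapsto\overline Z_p\overline X_q$, and fixes all other logical Paulis $\overline X,\overline Z$. *)

theory Defs
  imports
    "Jordan_Normal_Form.Matrix_Kernel"
    "Jordan_Normal_Form.Schur_Decomposition"
    "HOL-Library.Z2"
    "HOL-Library.Landau_Symbols"
begin

section \<open>Binary codes and their SLT bases\<close>

text \<open>
  A classical code is given by a parity-check matrix \<open>H\<close> over the two-element field
  \<^typ>\<open>bit\<close>; the code is \<^term>\<open>mat_kernel H\<close>. All coordinates are numbered from 0.
\<close>

definition hamming_weight :: "bit vec \<Rightarrow> nat" where
  "hamming_weight v = card {i. i < dim_vec v \<and> v $ i = 1}"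

text \<open>The infimum is a minimum as soon as the code is nonzero; it is unspecified otherwise.\<close>

definition code_distance :: "bit mat \<Rightarrow> nat" where
  "code_distance H = Inf (hamming_weight ` (mat_kernel H - {0\<^sub>v (dim_col H)}))"

definition slt_basis :: "bit mat \<Rightarrow> nat set \<Rightarrow> (nat \<Rightarrow> bit vec) \<Rightarrow> bool" where
  "slt_basis H P v \<longleftrightarrow>
     P \<subseteq> {..<dim_col H} \<and>
     kernel.basis (dim_col H) H (v ` P) \<and>
     (\<forall>i\<in>P. v i $ i = 1 \<and> (\<forall>i'\<in>P. i' \<noteq> i \<longrightarrow> v i' $ i = 0))"

definition kron_mat :: "'a::semiring_1 mat \<Rightarrow> 'a mat \<Rightarrow> 'a mat" where
  "kron_mat A B = mat (dim_row A * dim_row B) (dim_col A * dim_col B)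
     (\<lambda>(i, j). A $$ (i div dim_row B, j div dim_col B) * B $$ (i mod dim_row B, j mod dim_col B))"

definition kron_vec :: "'a::semiring_1 vec \<Rightarrow> 'a vec \<Rightarrow> 'a vec" where
  "kron_vec v w = vec (dim_vec v * dim_vec w) (\<lambda>i. v $ (i div dim_vec w) * w $ (i mod dim_vec w))"

definition append_cols :: "'a::zero mat \<Rightarrow> 'a mat \<Rightarrow> 'a mat" where
  "append_cols A B = mat (dim_row A) (dim_col A + dim_col B)
     (\<lambda>(i, j). if j < dim_col A then A $$ (i, j) else B $$ (i, j - dim_col A))"

section \<open>Operators on \<open>n\<close> qubits\<close>

text \<open>
  Operators on qubits \<open>0, \<dots>, n - 1\<close> are complex \<open>2\<^sup>n \<times> 2\<^sup>n\<close> matrices; the computational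
  basis state numbered \<open>x < 2\<^sup>n\<close> has qubit \<open>q\<close> in state \<^term>\<open>bit x q\<close>.
\<close>

definition pauli_X_mat :: "complex mat" where
  "pauli_X_mat = mat_of_rows_list 2 [[0, 1], [1, 0]]"

definition pauli_Y_mat :: "complex mat" where
  "pauli_Y_mat = mat_of_rows_list 2 [[0, - \<i>], [\<i>, 0]]"

definition pauli_Z_mat :: "complex mat" where
  "pauli_Z_mat = mat_of_rows_list 2 [[1, 0], [0, - 1]]"

text \<open>The tensor product over all \<open>q < n\<close> of the single-qubit operators \<open>P q\<close>.\<close>

definition tensor_op :: "nat \<Rightarrow> (nat \<Rightarrow> complex mat) \<Rightarrow> complex mat" where
  "tensor_op n P = mat (2 ^ n) (2 ^ n)
     (\<lambda>(x, y). \<Prod>q<n. P q $$ (of_bool (bit x q), of_bool (bit y q)))"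

definition X_op :: "nat \<Rightarrow> bit vec \<Rightarrow> complex mat" where
  "X_op n v = tensor_op n (\<lambda>q. if v $ q = 1 then pauli_X_mat else 1\<^sub>m 2)"

definition Z_op :: "nat \<Rightarrow> bit vec \<Rightarrow> complex mat" where
  "Z_op n v = tensor_op n (\<lambda>q. if v $ q = 1 then pauli_Z_mat else 1\<^sub>m 2)"

definition conj_by :: "complex mat \<Rightarrow> complex mat \<Rightarrow> complex mat" where
  "conj_by U P = U * P * mat_adjoint U"

section \<open>Clifford circuits\<close>

datatype gate =
    Pauli_X nat | Pauli_Y nat | Pauli_Z nat
  | Hadamard nat | Phase nat
  | CNOT nat nat | CZ nat nat | SWAP nat nat

fun gate_qubits :: "gate \<Rightarrow> nat list" where
  "gate_qubits (Pauli_X q) = [q]"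
| "gate_qubits (Pauli_Y q) = [q]"
| "gate_qubits (Pauli_Z q) = [q]"
| "gate_qubits (Hadamard q) = [q]"
| "gate_qubits (Phase q) = [q]"
| "gate_qubits (CNOT c t) = [c, t]"
| "gate_qubits (CZ q r) = [q, r]"
| "gate_qubits (SWAP q r) = [q, r]"

text \<open>
  Matrix of a gate on its own qubits. For two-qubit gates, the qubit listed first in
  \<^const>\<open>gate_qubits\<close> (the control of a CNOT) is the more significant bit of the index.
\<close>

fun gate_local :: "gate \<Rightarrow> complex mat" where
  "gate_local (Pauli_X q) = pauli_X_mat"
| "gate_local (Pauli_Y q) = pauli_Y_mat"
| "gate_local (Pauli_Z q) = pauli_Z_mat"
| "gate_local (Hadamard q) =
     complex_of_real (1 / sqrt 2) \<cdot>\<^sub>m mat_of_rows_list 2 [[1, 1], [1, - 1]]"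
| "gate_local (Phase q) = mat_of_rows_list 2 [[1, 0], [0, \<i>]]"
| "gate_local (CNOT c t) =
     mat_of_rows_list 4 [[1, 0, 0, 0], [0, 1, 0, 0], [0, 0, 0, 1], [0, 0, 1, 0]]"
| "gate_local (CZ q r) =
     mat_of_rows_list 4 [[1, 0, 0, 0], [0, 1, 0, 0], [0, 0, 1, 0], [0, 0, 0, - 1]]"
| "gate_local (SWAP q r) =
     mat_of_rows_list 4 [[1, 0, 0, 0], [0, 0, 1, 0], [0, 1, 0, 0], [0, 0, 0, 1]]"

text \<open>
  \<open>embed_op n qs G\<close> applies \<open>G\<close> to the qubits in the list \<open>qs\<close> and the identity to all others.
\<close>

definition local_index :: "nat list \<Rightarrow> nat \<Rightarrow> nat" where
  "local_index qs x = horner_sum of_bool 2 (map (bit x) (rev qs))"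

definition embed_op :: "nat \<Rightarrow> nat list \<Rightarrow> complex mat \<Rightarrow> complex mat" where
  "embed_op n qs G = mat (2 ^ n) (2 ^ n)
     (\<lambda>(x, y). if \<forall>q<n. q \<notin> set qs \<longrightarrow> bit x q = bit y q
               then G $$ (local_index qs x, local_index qs y) else 0)"

definition gate_op :: "nat \<Rightarrow> gate \<Rightarrow> complex mat" where
  "gate_op n g = embed_op n (gate_qubits g) (gate_local g)"

definition circuit_on :: "nat \<Rightarrow> gate list \<Rightarrow> bool" where
  "circuit_on n C \<longleftrightarrow> (\<forall>g\<in>set C. distinct (gate_qubits g) \<and> set (gate_qubits g) \<subseteq> {..<n})"

text \<open>The head of the list is the gate that is applied first.\<close>

fun circuit_op :: "nat \<Rightarrow> gate list \<Rightarrow> complex mat" where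
  "circuit_op n [] = 1\<^sub>m (2 ^ n)"
| "circuit_op n (g # C) = circuit_op n C * gate_op n g"

text \<open>
  \<open>U\<close> acts as the identity on qubit \<open>q\<close> iff it is the tensor product of the identity on \<open>q\<close>
  with some operator \<open>V\<close> on the remaining qubits. The basis states of the remaining qubits are
  represented by the numbers whose bit \<open>q\<close> is 0.
\<close>

definition identity_on_qubit :: "nat \<Rightarrow> complex mat \<Rightarrow> nat \<Rightarrow> bool" where
  "identity_on_qubit n U q \<longleftrightarrow>
     (\<exists>V :: nat \<Rightarrow> nat \<Rightarrow> complex. \<forall>x<2 ^ n. \<forall>y<2 ^ n.
        U $$ (x, y) = (if bit x q = bit y q then V (unset_bit q x) (unset_bit q y) else 0))"

definition op_support :: "nat \<Rightarrow> complex mat \<Rightarrow> nat set" where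
  "op_support n U =
     (LEAST A. A \<subseteq> {..<n} \<and> (\<forall>q\<in>{..<n} - A. identity_on_qubit n U q))"

text \<open>The least set required above always exists:\<close>

lemma op_support_eq: "op_support n U = {q. q < n \<and> \<not> identity_on_qubit n U q}"
  unfolding op_support_def by (rule Least_equality) auto

definition support_size :: "nat \<Rightarrow> gate list \<Rightarrow> nat" where
  "support_size n C = card (op_support n (circuit_op n C))"

text \<open>
  An arrangement into layers must not change the circuit, so gates that overlap on a qubit have to
  keep their order. Every circuit admits such an arrangement, with one gate per layer.
\<close>

definition layering :: "gate list \<Rightarrow> nat \<Rightarrow> (nat \<Rightarrow> nat) \<Rightarrow> bool" where
  "layering C d f \<longleftrightarrow>
     (\<forall>s<length C. f s < d) \<and>
     (\<forall>s t. s < t \<and> t < length C \<and> set (gate_qubits (C ! s)) \<inter> set (gate_qubits (C ! t)) \<noteq> {}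
        \<longrightarrow> f s < f t)"

definition circuit_depth :: "gate list \<Rightarrow> nat" where
  "circuit_depth C = (LEAST d. \<exists>f. layering C d f)"

section \<open>Hypergraph product codes with SLT logical operators\<close>

text \<open>
  \<open>piv_a, vec_a\<close> are the pivots and vectors of the basis \<open>{a\<^sub>i}\<close> of \<open>ker H\<^sub>a\<close>, and
  \<open>piv_b, vec_b\<close> those of the basis \<open>{b\<^sub>h}\<close> of \<open>ker H\<^sub>b\<close>. Likewise \<open>piv_at, vec_at\<close> belong to
  the basis \<open>{\<alpha>\<^sub>j}\<close> of the kernel of \<open>H\<^sub>a\<close> transposed, and \<open>piv_bt, vec_bt\<close> to the basis
  \<open>{\<beta>\<^sub>l}\<close> of the kernel of \<open>H\<^sub>b\<close> transposed.
\<close>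

record hgp =
  H_a :: "bit mat"
  H_b :: "bit mat"
  piv_a :: "nat set"
  vec_a :: "nat \<Rightarrow> bit vec"
  piv_at :: "nat set"
  vec_at :: "nat \<Rightarrow> bit vec"
  piv_b :: "nat set"
  vec_b :: "nat \<Rightarrow> bit vec"
  piv_bt :: "nat set"
  vec_bt :: "nat \<Rightarrow> bit vec"

definition slt_hgp :: "hgp \<Rightarrow> bool" where
  "slt_hgp Q \<longleftrightarrow>
     slt_basis (H_a Q) (piv_a Q) (vec_a Q) \<and>
     slt_basis (transpose_mat (H_a Q)) (piv_at Q) (vec_at Q) \<and>
     slt_basis (H_b Q) (piv_b Q) (vec_b Q) \<and>
     slt_basis (transpose_mat (H_b Q)) (piv_bt Q) (vec_bt Q)"

definition n_a :: "hgp \<Rightarrow> nat" where "n_a Q = dim_col (H_a Q)"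
definition m_a :: "hgp \<Rightarrow> nat" where "m_a Q = dim_row (H_a Q)"
definition n_b :: "hgp \<Rightarrow> nat" where "n_b Q = dim_col (H_b Q)"
definition m_b :: "hgp \<Rightarrow> nat" where "m_b Q = dim_row (H_b Q)"

definition num_qubits :: "hgp \<Rightarrow> nat" where
  "num_qubits Q = n_a Q * n_b Q + m_a Q * m_b Q"

definition H_X :: "hgp \<Rightarrow> bit mat" where
  "H_X Q = append_cols (kron_mat (H_a Q) (1\<^sub>m (n_b Q)))
                       (kron_mat (1\<^sub>m (m_a Q)) (transpose_mat (H_b Q)))"

definition H_Z :: "hgp \<Rightarrow> bit mat" where
  "H_Z Q = append_cols (kron_mat (1\<^sub>m (n_a Q)) (H_b Q))
                       (kron_mat (transpose_mat (H_a Q)) (1\<^sub>m (m_b Q)))"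

definition stabilizer_generators :: "hgp \<Rightarrow> complex mat set" where
  "stabilizer_generators Q =
     {X_op (num_qubits Q) (row (H_X Q) r) | r. r < dim_row (H_X Q)} \<union>
     {Z_op (num_qubits Q) (row (H_Z Q) r) | r. r < dim_row (H_Z Q)}"

text \<open>\<open>LeftQ i h\<close> and \<open>RightQ j l\<close> are the labels \<open>(i, h, L)\<close> and \<open>(j, l, R)\<close>.\<close>

datatype logical_qubit = LeftQ nat nat | RightQ nat nat

definition logical_qubits :: "hgp \<Rightarrow> logical_qubit set" where
  "logical_qubits Q =
     {LeftQ i h | i h. i \<in> piv_a Q \<and> h \<in> piv_b Q} \<union>
     {RightQ j l | j l. j \<in> piv_at Q \<and> l \<in> piv_bt Q}"

fun logical_X_vec :: "hgp \<Rightarrow> logical_qubit \<Rightarrow> bit vec" where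
  "logical_X_vec Q (LeftQ i h) =
     kron_vec (unit_vec (n_a Q) i) (vec_b Q h) @\<^sub>v 0\<^sub>v (m_a Q * m_b Q)"
| "logical_X_vec Q (RightQ j l) =
     0\<^sub>v (n_a Q * n_b Q) @\<^sub>v kron_vec (vec_at Q j) (unit_vec (m_b Q) l)"

fun logical_Z_vec :: "hgp \<Rightarrow> logical_qubit \<Rightarrow> bit vec" where
  "logical_Z_vec Q (LeftQ i h) =
     kron_vec (vec_a Q i) (unit_vec (n_b Q) h) @\<^sub>v 0\<^sub>v (m_a Q * m_b Q)"
| "logical_Z_vec Q (RightQ j l) =
     0\<^sub>v (n_a Q * n_b Q) @\<^sub>v kron_vec (unit_vec (m_a Q) j) (vec_bt Q l)"

definition logical_X :: "hgp \<Rightarrow> logical_qubit \<Rightarrow> complex mat" where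
  "logical_X Q p = X_op (num_qubits Q) (logical_X_vec Q p)"

definition logical_Z :: "hgp \<Rightarrow> logical_qubit \<Rightarrow> complex mat" where
  "logical_Z Q p = Z_op (num_qubits Q) (logical_Z_vec Q p)"

text \<open>
  A logical gate is described by the images \<open>gX p\<close>, \<open>gZ p\<close> that it prescribes for the logical
  Paulis \<open>X\<close> and \<open>Z\<close> of each logical qubit \<open>p\<close>. These images are attained up to a global phase
  only, whereas the stabilizer generators have to be fixed exactly.
\<close>

definition eq_up_to_phase :: "complex mat \<Rightarrow> complex mat \<Rightarrow> bool" where
  "eq_up_to_phase A B \<longleftrightarrow> (\<exists>c. cmod c = 1 \<and> A = c \<cdot>\<^sub>m B)"

definition implements ::
  "hgp \<Rightarrow> (logical_qubit \<Rightarrow> complex mat) \<Rightarrow> (logical_qubit \<Rightarrow> complex mat) \<Rightarrow> gate list \<Rightarrow> bool" where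
  "implements Q gX gZ C \<longleftrightarrow>
     (let U = circuit_op (num_qubits Q) C in
        (\<forall>S\<in>stabilizer_generators Q. conj_by U S = S) \<and>
        (\<forall>p\<in>logical_qubits Q.
           eq_up_to_phase (conj_by U (logical_X Q p)) (gX p) \<and>
           eq_up_to_phase (conj_by U (logical_Z Q p)) (gZ p)))"

definition implements_CZ :: "hgp \<Rightarrow> logical_qubit \<Rightarrow> logical_qubit \<Rightarrow> gate list \<Rightarrow> bool" where
  "implements_CZ Q p q C \<longleftrightarrow>
     implements Q
       (\<lambda>r. if r = p then logical_X Q p * logical_Z Q q
            else if r = q then logical_Z Q p * logical_X Q q
            else logical_X Q r)
       (logical_Z Q) C"

section \<open>Scaling assumptions\<close>

text \<open>
  The final conjunct bounds the weights of all vectors of all four bases uniformly. For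
  \<open>a\<^sub>i\<close> and \<open>b\<^sub>h\<close> it follows from the preceding ones; for \<open>\<alpha>\<^sub>j\<close> and \<open>\<beta>\<^sub>l\<close> it is the only
  assumption made about the transposed codes.
\<close>

definition hgp_scaling :: "(nat \<Rightarrow> hgp) \<Rightarrow> bool" where
  "hgp_scaling Q \<longleftrightarrow>
     filterlim (\<lambda>k. num_qubits (Q k)) at_top sequentially \<and>
     (\<lambda>k. real (n_a (Q k))) \<in> \<Theta>(\<lambda>k. sqrt (real (num_qubits (Q k)))) \<and>
     (\<lambda>k. real (n_b (Q k))) \<in> \<Theta>(\<lambda>k. sqrt (real (num_qubits (Q k)))) \<and>
     (\<lambda>k. real (kernel_dim (H_a (Q k)))) \<in> \<Theta>(\<lambda>k. real (n_a (Q k))) \<and>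
     (\<lambda>k. real (kernel_dim (H_b (Q k)))) \<in> \<Theta>(\<lambda>k. real (n_b (Q k))) \<and>
     (\<lambda>k. real (code_distance (H_a (Q k)))) \<in> \<Theta>(\<lambda>k. real (n_a (Q k))) \<and>
     (\<lambda>k. real (code_distance (H_b (Q k)))) \<in> \<Theta>(\<lambda>k. real (n_b (Q k))) \<and>
     (\<exists>c1>0. \<exists>c2>0. \<forall>\<^sub>F k in sequentially.
        \<forall>v \<in> vec_a (Q k) ` piv_a (Q k) \<union> vec_at (Q k) ` piv_at (Q k) \<union>
             vec_b (Q k) ` piv_b (Q k) \<union> vec_bt (Q k) ` piv_bt (Q k).
          c1 * sqrt (real (num_qubits (Q k))) \<le> real (hamming_weight v) \<and>
          real (hamming_weight v) \<le> c2 * sqrt (real (num_qubits (Q k))))"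

text \<open>
  For the codes of a sequence, support size and depth being of order \<open>\<Theta>(\<surd>n)\<close> means that they lie
  between \<open>c1 * \<surd>n\<close> and \<open>c2 * \<surd>n\<close>, where \<open>c1\<close> and \<open>c2\<close> depend on the sequence only.
\<close>

definition order_sqrt :: "real \<Rightarrow> real \<Rightarrow> hgp \<Rightarrow> gate list \<Rightarrow> bool" where
  "order_sqrt c1 c2 Q C \<longleftrightarrow>
     (let n = num_qubits Q in
        c1 * sqrt (real n) \<le> real (support_size n C) \<and>
        real (support_size n C) \<le> c2 * sqrt (real n) \<and>
        c1 * sqrt (real n) \<le> real (circuit_depth C) \<and>
        real (circuit_depth C) \<le> c2 * sqrt (real n))"

end

theory Submission
  imports Defs
begin

text \<open>
  If \<open>z\<close> and \<open>w\<close> are the supports of the logical operators \<open>Z\<close> of the qubits \<open>p\<close> and \<open>q\<close>, then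
  the diagonal unitary with entries \<open>(-1)^((z \<bullet> x) (w \<bullet> x))\<close> commutes with all \<open>Z\<close>-type operators
  and multiplies the \<open>X\<close>-type operator with support \<open>v\<close> by the \<open>Z\<close>-type operator with support
  \<open>(z \<bullet> v) w + (w \<bullet> v) z\<close>, up to sign. As \<open>z\<close> and \<open>w\<close> are orthogonal to the rows of \<open>H\<^sub>X\<close> and dual to
  the logical operators \<open>X\<close>, it implements the logical CZ gate. Its support is the union of the
  supports of \<open>z\<close> and \<open>w\<close>. Since each of \<open>z\<close>, \<open>w\<close> vanishes on the pivot of the other, CNOT gates can
  collect the two parities on the pivots, where a single CZ gate acts before the CNOT gates are
  undone. All CNOT gates for \<open>z\<close> share its pivot, which makes the depth at least the weight of \<open>z\<close>.
\<close>

unbundle bit_operations_syntax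

text \<open>
  Otherwise the simplifier turns the field arithmetic of \<^typ>\<open>Z2.bit\<close> into boolean operations and
  parities into cardinalities.
\<close>

declare add_bit_eq_xor [simp del] mult_bit_eq_and [simp del]
  sum_of_bool_eq [simp del] sum_mult_of_bool_eq [simp del] sum_of_bool_mult_eq [simp del]

section \<open>Monomial matrices\<close>

text \<open>\<open>X\<close>- and \<open>Z\<close>-type Paulis, CNOT and CZ all have this form, so
  identities between operators reduce to identities between phases \<open>s\<close> and between maps
  \<open>f\<close> of basis states.\<close>

definition monomial_op :: "nat \<Rightarrow> (nat \<Rightarrow> complex) \<Rightarrow> (nat \<Rightarrow> nat) \<Rightarrow> complex mat" where
  "monomial_op n s f = mat (2 ^ n) (2 ^ n) (\<lambda>(x, y). if x = f y then s y else 0)"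

abbreviation diag_op :: "nat \<Rightarrow> (nat \<Rightarrow> complex) \<Rightarrow> complex mat" where
  "diag_op n s \<equiv> monomial_op n s (\<lambda>y. y)"

lemma monomial_op_carrier [simp]: "monomial_op n s f \<in> carrier_mat (2 ^ n) (2 ^ n)"
  by (simp add: monomial_op_def)

lemma monomial_op_cong:
  assumes "\<And>y. y < 2 ^ n \<Longrightarrow> s y = t y" and "\<And>y. y < 2 ^ n \<Longrightarrow> f y = g y"
  shows "monomial_op n s f = monomial_op n t g"
  using assms by (auto simp: monomial_op_def)

text \<open>The bound on \<open>g\<close> keeps every nonzero entry of the right factor inside the
  matrix; otherwise a column would be lost in the product.\<close>

lemma monomial_op_mult:
  assumes "\<And>y. y < 2 ^ n \<Longrightarrow> g y < 2 ^ n"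
  shows "monomial_op n s f * monomial_op n t g = monomial_op n (\<lambda>y. s (g y) * t y) (\<lambda>y. f (g y))"
proof (rule eq_matI)
  fix i j
  assume "i < dim_row (monomial_op n (\<lambda>y. s (g y) * t y) (\<lambda>y. f (g y)))"
    and "j < dim_col (monomial_op n (\<lambda>y. s (g y) * t y) (\<lambda>y. f (g y)))"
  then have ij: "i < 2 ^ n" "j < 2 ^ n" by (auto simp: monomial_op_def)
  have "(monomial_op n s f * monomial_op n t g) $$ (i, j) =
    (\<Sum>k\<in>{0..<2 ^ n}. (if i = f k then s k else 0) * (if k = g j then t j else 0))"
    using ij by (simp add: monomial_op_def scalar_prod_def)
  also have "\<dots> = (\<Sum>k\<in>{0..<2 ^ n}. if k = g j then (if i = f k then s k else 0) * t j else 0)"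
    by (intro sum.cong) auto
  also have "\<dots> = (if i = f (g j) then s (g j) else 0) * t j"
    using assms ij by (subst sum.delta) auto
  finally show "(monomial_op n s f * monomial_op n t g) $$ (i, j) =
      monomial_op n (\<lambda>y. s (g y) * t y) (\<lambda>y. f (g y)) $$ (i, j)"
    using ij by (simp add: monomial_op_def)
qed (auto simp: monomial_op_def)

lemma mat_adjoint_diag_op: "mat_adjoint (diag_op n s) = diag_op n (\<lambda>y. cnj (s y))"
  by (rule eq_matI) (auto simp: mat_adjoint_def monomial_op_def mat_of_rows_def)

section \<open>Basis states as bit strings\<close>

lemma eq_iff_bits:
  fixes x y :: nat
  assumes "x < 2 ^ n" "y < 2 ^ n"
  shows "x = y \<longleftrightarrow> (\<forall>q<n. bit x q = bit y q)"
proof -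
  have "x = y \<longleftrightarrow> take_bit n x = take_bit n y"
    using assms by (simp add: take_bit_nat_eq_self)
  also have "\<dots> \<longleftrightarrow> (\<forall>q<n. bit x q = bit y q)"
    by (subst bit_eq_iff) (auto simp: bit_take_bit_iff)
  finally show ?thesis .
qed

lemma less_exp_iff_bits: "(x::nat) < 2 ^ n \<longleftrightarrow> (\<forall>q\<ge>n. \<not> bit x q)"
proof -
  have "take_bit n x = x \<longleftrightarrow> (\<forall>q\<ge>n. \<not> bit x q)"
  proof
    assume eq: "take_bit n x = x"
    show "\<forall>q\<ge>n. \<not> bit x q"
    proof (intro allI impI)
      fix q
      assume "n \<le> q"
      then show "\<not> bit x q"
        using arg_cong[OF eq, of "\<lambda>x. bit x q"] by (simp add: bit_take_bit_iff)
    qed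
  next
    assume high: "\<forall>q\<ge>n. \<not> bit x q"
    show "take_bit n x = x"
    proof (rule bit_eqI)
      fix q
      show "bit (take_bit n x) q = bit x q"
        using high by (cases "q < n") (simp_all add: bit_take_bit_iff)
    qed
  qed
  then show ?thesis by (simp add: take_bit_nat_eq_self_iff)
qed

text \<open>This is the mask of bits that the \<open>X\<close>-type operator with support
  \<open>v\<close> flips.\<close>

definition state_of_vec :: "nat \<Rightarrow> bit vec \<Rightarrow> nat" where
  "state_of_vec n v = horner_sum of_bool 2 (map (\<lambda>q. v $ q = 1) [0..<n])"

lemma bit_state_of_vec: "bit (state_of_vec n v) q \<longleftrightarrow> q < n \<and> v $ q = 1"
  by (auto simp: state_of_vec_def bit_horner_sum_bit_iff)

lemma xor_less_exp: "(x::nat) < 2 ^ n \<Longrightarrow> y < 2 ^ n \<Longrightarrow> x XOR y < 2 ^ n"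
  by (auto simp: less_exp_iff_bits bit_xor_iff)

lemma state_of_vec_less: "state_of_vec n v < 2 ^ n"
  by (auto simp: less_exp_iff_bits bit_state_of_vec)

text \<open>A linear form on bit strings. Its coefficients are a function rather than a vector, so
  that a CNOT can change one of them without any dimension to carry along.\<close>

definition parity_on :: "nat \<Rightarrow> (nat \<Rightarrow> bit) \<Rightarrow> nat \<Rightarrow> bit" where
  "parity_on n z x = (\<Sum>q<n. z q * of_bool (bit x q))"

lemma parity_on_xor: "parity_on n z (x XOR y) = parity_on n z x + parity_on n z y"
  unfolding parity_on_def sum.distrib[symmetric]
  by (intro sum.cong) (auto simp: bit_xor_iff)

lemma parity_on_zero [simp]: "parity_on n z 0 = 0"
  by (simp add: parity_on_def)

lemma parity_on_exp: "q < n \<Longrightarrow> parity_on n z (2 ^ q) = z q"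
proof -
  assume "q < n"
  have "parity_on n z (2 ^ q) = (\<Sum>r<n. if r = q then z r else 0)"
    unfolding parity_on_def by (intro sum.cong) (auto simp: bit_exp_iff)
  then show ?thesis using \<open>q < n\<close> by simp
qed

lemma parity_on_state_of_vec:
  assumes "dim_vec v = n"
  shows "parity_on n (\<lambda>q. z $ q) (state_of_vec n v) = z \<bullet> v"
proof -
  have "z $ q * of_bool (v $ q = 1) = z $ q * v $ q" for q
    by (cases "v $ q") auto
  then show ?thesis
    using assms by (auto simp: parity_on_def scalar_prod_def bit_state_of_vec lessThan_atLeast0 intro!: sum.cong)
qed

text \<open>The nontrivial character of the additive group of the two-element field.\<close>

definition bit_sign :: "bit \<Rightarrow> complex" where
  "bit_sign b = (if b = 1 then - 1 else 1)"

lemma bit_sign_add: "bit_sign (a + b) = bit_sign a * bit_sign b"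
  by (cases a; cases b) (auto simp: bit_sign_def)

lemma bit_sign_simps [simp]: "bit_sign 0 = 1" "bit_sign 1 = - 1"
  by (auto simp: bit_sign_def)

lemma bit_sign_eq_iff [simp]: "bit_sign a = bit_sign b \<longleftrightarrow> a = b"
  by (cases a; cases b) auto

lemma cnj_bit_sign [simp]: "cnj (bit_sign b) = bit_sign b"
  by (cases b) auto

lemma bit_sign_sum: "finite A \<Longrightarrow> bit_sign (\<Sum>a\<in>A. f a) = (\<Prod>a\<in>A. bit_sign (f a))"
  by (induction A rule: finite_induct) (auto simp: bit_sign_add)

section \<open>Pauli operators as monomial matrices\<close>

lemma prod_of_bool:
  "finite A \<Longrightarrow> (\<Prod>a\<in>A. of_bool (P a)) = (of_bool (\<forall>a\<in>A. P a) :: complex)"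
  by (induction A rule: finite_induct) auto

text \<open>Each tensor factor is an indicator: the bits of \<open>x\<close> and \<open>y\<close>
  differ exactly if \<open>v\<close> is 1 there. The product over all qubits is the indicator of
  \<open>x\<close> being \<open>y\<close> with the mask applied.\<close>

lemma X_op_eq: "X_op n v = monomial_op n (\<lambda>y. 1) (\<lambda>y. y XOR state_of_vec n v)"
proof (rule eq_matI)
  fix x y
  assume "x < dim_row (monomial_op n (\<lambda>y. 1) (\<lambda>y. y XOR state_of_vec n v))"
    and "y < dim_col (monomial_op n (\<lambda>y. 1) (\<lambda>y. y XOR state_of_vec n v))"
  then have xy: "x < 2 ^ n" "y < 2 ^ n" by (auto simp: monomial_op_def)
  have "(if v $ q = 1 then pauli_X_mat else 1\<^sub>m 2) $$ (of_bool (bit x q), of_bool (bit y q)) =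
      of_bool (bit x q = bit (y XOR state_of_vec n v) q)" if "q < n" for q
    using that by (cases "v $ q"; cases "bit x q"; cases "bit y q")
      (auto simp: bit_xor_iff bit_state_of_vec pauli_X_mat_def mat_of_rows_list_def)
  then have "X_op n v $$ (x, y) = of_bool (\<forall>q\<in>{..<n}. bit x q = bit (y XOR state_of_vec n v) q)"
    using xy by (simp add: X_op_def tensor_op_def prod_of_bool)
  also have "(\<forall>q\<in>{..<n}. bit x q = bit (y XOR state_of_vec n v) q) \<longleftrightarrow> x = y XOR state_of_vec n v"
    using eq_iff_bits[OF xy(1) xor_less_exp[OF xy(2) state_of_vec_less]] by auto
  finally show "X_op n v $$ (x, y) = monomial_op n (\<lambda>y. 1) (\<lambda>y. y XOR state_of_vec n v) $$ (x, y)"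
    using xy by (simp add: monomial_op_def)
qed (auto simp: monomial_op_def X_op_def tensor_op_def)

lemma Z_op_eq: "Z_op n v = diag_op n (\<lambda>y. bit_sign (parity_on n (\<lambda>q. v $ q) y))"
proof (rule eq_matI)
  fix x y
  assume "x < dim_row (diag_op n (\<lambda>y. bit_sign (parity_on n (\<lambda>q. v $ q) y)))"
    and "y < dim_col (diag_op n (\<lambda>y. bit_sign (parity_on n (\<lambda>q. v $ q) y)))"
  then have xy: "x < 2 ^ n" "y < 2 ^ n" by (auto simp: monomial_op_def)
  have "(if v $ q = 1 then pauli_Z_mat else 1\<^sub>m 2) $$ (of_bool (bit x q), of_bool (bit y q)) =
      of_bool (bit x q = bit y q) * bit_sign (v $ q * of_bool (bit y q))" for q
    by (cases "v $ q"; cases "bit x q"; cases "bit y q")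
      (auto simp: pauli_Z_mat_def mat_of_rows_list_def)
  then have "Z_op n v $$ (x, y) =
      of_bool (\<forall>q\<in>{..<n}. bit x q = bit y q) * bit_sign (parity_on n (\<lambda>q. v $ q) y)"
    using xy by (simp add: Z_op_def tensor_op_def prod.distrib parity_on_def bit_sign_sum prod_of_bool)
  also have "(\<forall>q\<in>{..<n}. bit x q = bit y q) \<longleftrightarrow> x = y"
    using eq_iff_bits[OF xy] by auto
  finally show "Z_op n v $$ (x, y) = diag_op n (\<lambda>y. bit_sign (parity_on n (\<lambda>q. v $ q) y)) $$ (x, y)"
    using xy by (simp add: monomial_op_def)
qed (auto simp: monomial_op_def Z_op_def tensor_op_def)

section \<open>The controlled phase of two parities\<close>

definition parity_CZ_op :: "nat \<Rightarrow> (nat \<Rightarrow> bit) \<Rightarrow> (nat \<Rightarrow> bit) \<Rightarrow> complex mat" where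
  "parity_CZ_op n z w = diag_op n (\<lambda>y. bit_sign (parity_on n z y * parity_on n w y))"

lemma parity_CZ_op_commute: "parity_CZ_op n z w = parity_CZ_op n w z"
  by (simp add: parity_CZ_op_def mult.commute)

lemma parity_CZ_op_cong:
  assumes "\<And>q. q < n \<Longrightarrow> z q = z' q" and "\<And>q. q < n \<Longrightarrow> w q = w' q"
  shows "parity_CZ_op n z w = parity_CZ_op n z' w'"
proof -
  have "parity_on n z = parity_on n z'" "parity_on n w = parity_on n w'"
    using assms by (auto simp: parity_on_def)
  then show ?thesis by (simp add: parity_CZ_op_def)
qed

text \<open>The shift by \<open>v\<close> adds \<open>c = z \<bullet> v\<close> and
  \<open>d = w \<bullet> v\<close> to the parities \<open>a\<close> and \<open>b\<close>, and
  \<open>(a + c) * (b + d) + a * b = c * b + d * a + c * d\<close> over the two-element field. The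
  last hypothesis removes the constant \<open>c * d\<close>, a global sign, so the equation is
  exact.\<close>

lemma conj_by_parity_CZ_op_X_op:
  assumes v: "dim_vec v = n" and zw: "dim_vec z = n" "dim_vec w = n" and "z \<bullet> v = 0 \<or> w \<bullet> v = 0"
  shows "conj_by (parity_CZ_op n (\<lambda>q. z $ q) (\<lambda>q. w $ q)) (X_op n v) =
    X_op n v * Z_op n ((z \<bullet> v) \<cdot>\<^sub>v w + (w \<bullet> v) \<cdot>\<^sub>v z)"
proof -
  define p where "p = parity_on n (\<lambda>q. z $ q)"
  define r where "r = parity_on n (\<lambda>q. w $ q)"
  have lin: "parity_on n (\<lambda>q. ((z \<bullet> v) \<cdot>\<^sub>v w + (w \<bullet> v) \<cdot>\<^sub>v z) $ q) y = (z \<bullet> v) * r y + (w \<bullet> v) * p y" for y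
  proof -
    have "parity_on n (\<lambda>q. ((z \<bullet> v) \<cdot>\<^sub>v w + (w \<bullet> v) \<cdot>\<^sub>v z) $ q) y =
        (\<Sum>q<n. (z \<bullet> v) * (w $ q * of_bool (bit y q)) + (w \<bullet> v) * (z $ q * of_bool (bit y q)))"
      unfolding parity_on_def by (rule sum.cong) (use zw in \<open>simp_all add: distrib_right mult.assoc\<close>)
    then show ?thesis
      by (simp only: p_def r_def parity_on_def sum.distrib sum_distrib_left)
  qed
  have pv: "p (y XOR state_of_vec n v) = p y + z \<bullet> v" "r (y XOR state_of_vec n v) = r y + w \<bullet> v" for y
    using parity_on_state_of_vec[OF v] by (simp_all only: p_def r_def parity_on_xor)
  have sgn: "bit_sign ((a + c) * (b + d)) * bit_sign (a * b) = bit_sign (c * b + d * a)"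
    if "c = 0 \<or> d = 0" for a b c d :: Z2.bit
    using that by (cases a; cases b; cases c; cases d) simp_all
  have less: "y XOR state_of_vec n v < 2 ^ n" if "y < 2 ^ n" for y
    using that state_of_vec_less by (rule xor_less_exp)
  have "conj_by (parity_CZ_op n (\<lambda>q. z $ q) (\<lambda>q. w $ q)) (X_op n v) =
      monomial_op n (\<lambda>y. bit_sign ((p y + z \<bullet> v) * (r y + w \<bullet> v)) * bit_sign (p y * r y))
        (\<lambda>y. y XOR state_of_vec n v)"
    unfolding conj_by_def parity_CZ_op_def mat_adjoint_diag_op X_op_eq
    by (simp only: monomial_op_mult less mult_1_right cnj_bit_sign pv flip: p_def r_def)
  also have "\<dots> = X_op n v * Z_op n ((z \<bullet> v) \<cdot>\<^sub>v w + (w \<bullet> v) \<cdot>\<^sub>v z)"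
    unfolding X_op_eq Z_op_eq by (simp only: monomial_op_mult lin sgn[OF assms(4)] mult_1_left)
  finally show ?thesis .
qed

lemma conj_by_parity_CZ_op_Z_op: "conj_by (parity_CZ_op n z w) (Z_op n v) = Z_op n v"
proof -
  have "bit_sign a * bit_sign b * bit_sign a = bit_sign b" for a b
    by (cases a) auto
  then show ?thesis
    unfolding conj_by_def parity_CZ_op_def mat_adjoint_diag_op Z_op_eq
    by (auto simp: monomial_op_mult intro!: monomial_op_cong)
qed

text \<open>The shift by \<open>v\<close> leaves the parity for \<open>z\<close> unchanged. This is
  needed because the prescribed image of \<open>X\<close> on the second qubit of a logical CZ has
  its \<open>Z\<close> factor in front.\<close>

lemma X_op_mult_Z_op_commute:
  assumes "dim_vec v = n" "z \<bullet> v = 0"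
  shows "X_op n v * Z_op n z = Z_op n z * X_op n v"
  unfolding X_op_eq Z_op_eq using xor_less_exp[OF _ state_of_vec_less[of n v]] assms
  by (auto simp: monomial_op_mult parity_on_xor parity_on_state_of_vec intro!: monomial_op_cong)

text \<open>A qubit \<open>r\<close> with \<open>z r = 1\<close> or \<open>w r = 1\<close> is
  detected by a basis state at which flipping bit \<open>r\<close> changes the product of the two
  parities. The pivots provide such a state when only one of the forms involves
  \<open>r\<close>.\<close>

lemma op_support_parity_CZ_op:
  assumes "p < n" "q < n" "z p = 1" "w p = 0" "w q = 1" "z q = 0"
  shows "op_support n (parity_CZ_op n z w) = {r. r < n \<and> (z r = 1 \<or> w r = 1)}"
proof -
  have diag: "parity_CZ_op n z w $$ (x, x) = bit_sign (parity_on n z x * parity_on n w x)"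
    if "x < 2 ^ n" for x
    using that by (simp add: parity_CZ_op_def monomial_op_def)
  have nontrivial: "\<not> identity_on_qubit n (parity_CZ_op n z w) r"
    if r: "r < n" and "x < 2 ^ n" "\<not> bit x r"
      and neq: "parity_on n z x * parity_on n w x \<noteq> (parity_on n z x + z r) * (parity_on n w x + w r)"
    for r x
  proof
    assume "identity_on_qubit n (parity_CZ_op n z w) r"
    then obtain V where V: "\<And>x y. x < 2 ^ n \<Longrightarrow> y < 2 ^ n \<Longrightarrow> parity_CZ_op n z w $$ (x, y) =
        (if bit x r = bit y r then V (unset_bit r x) (unset_bit r y) else 0)"
      unfolding identity_on_qubit_def by blast
    \<comment> \<open>Both states agree away from \<open>r\<close>, so an operator that is trivial
      on \<open>r\<close> has equal diagonal entries at them.\<close>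
    define x' where "x' = x XOR 2 ^ r"
    have x': "x' < 2 ^ n" "unset_bit r x' = unset_bit r x"
      using r that(2) by (auto simp: x'_def xor_less_exp bit_simps intro!: bit_eqI)
    have "parity_CZ_op n z w $$ (x, x) = parity_CZ_op n z w $$ (x', x')"
      using V[of x x] V[of x' x'] x' that(2) by simp
    then show False
      using neq x' that(2) r by (simp add: diag) (simp add: x'_def parity_on_xor parity_on_exp)
  qed
  have "\<not> identity_on_qubit n (parity_CZ_op n z w) r \<longleftrightarrow> z r = 1 \<or> w r = 1" if r: "r < n" for r
  proof (cases "z r = 1 \<or> w r = 1")
    case True
    have "z r = 1 \<and> w r = 1 \<or> z r = 1 \<and> w r = 0 \<or> z r = 0 \<and> w r = 1"
      using True by (metis bit_not_one_iff)
    then consider "z r = 1" "w r = 1" | "z r = 1" "w r = 0" | "z r = 0" "w r = 1"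
      by blast
    then have "\<not> identity_on_qubit n (parity_CZ_op n z w) r"
    proof cases
      \<comment> \<open>At \<open>0\<close> both parities are 0, and flipping \<open>r\<close> makes
        both 1.\<close>
      case 1
      then show ?thesis by (intro nontrivial[of r 0] r) auto
    next
      \<comment> \<open>At \<open>2 ^ q\<close> the parity for \<open>w\<close> is already 1 and
        that for \<open>z\<close> is 0; flipping \<open>r\<close> changes only the latter. The next
        case is symmetric, with \<open>p\<close> in place of \<open>q\<close>.\<close>
      case 2
      then show ?thesis using assms
        by (intro nontrivial[of r "2 ^ q"] r) (auto simp: parity_on_exp bit_exp_iff)
    next
      case 3
      then show ?thesis using assms
        by (intro nontrivial[of r "2 ^ p"] r) (auto simp: parity_on_exp bit_exp_iff)
    qed
    then show ?thesis using True by simp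
  next
    case False
    then have zw: "z r = 0" "w r = 0" by auto
    have unset: "parity_on n u (unset_bit r x) = parity_on n u x" if "u r = 0" for u x
      using that by (auto simp: parity_on_def bit_simps intro!: sum.cong)
    have eq: "x = y \<longleftrightarrow> unset_bit r x = unset_bit r y" if "bit x r = bit y r" for x y :: nat
    proof
      assume unset_eq: "unset_bit r x = unset_bit r y"
      show "x = y"
      proof (rule bit_eqI)
        fix q
        show "bit x q = bit y q"
          using that arg_cong[OF unset_eq, of "\<lambda>x. bit x q"] by (cases "q = r") (auto simp: bit_simps)
      qed
    qed simp
    \<comment> \<open>Neither parity depends on bit \<open>r\<close>, so the same diagonal phases
      serve as the operator on the remaining qubits.\<close>
    have "identity_on_qubit n (parity_CZ_op n z w) r"
      unfolding identity_on_qubit_def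
      by (rule exI[of _ "\<lambda>x y. if x = y then bit_sign (parity_on n z x * parity_on n w x) else 0"])
        (auto simp: parity_CZ_op_def monomial_op_def unset zw eq)
    then show ?thesis using False by simp
  qed
  then show ?thesis by (auto simp: op_support_eq)
qed

section \<open>Circuits of CNOT and CZ gates\<close>

lemma gate_op_carrier [simp]: "gate_op n g \<in> carrier_mat (2 ^ n) (2 ^ n)"
  by (simp add: gate_op_def embed_op_def)

lemma circuit_op_carrier [simp]: "circuit_op n C \<in> carrier_mat (2 ^ n) (2 ^ n)"
  by (induction C) auto

lemma circuit_op_append: "circuit_op n (C @ D) = circuit_op n D * circuit_op n C"
proof (induction C)
  case Nil
  show ?case using right_mult_one_mat[OF circuit_op_carrier[of n D]] by simp
next
  case (Cons g C)
  then show ?case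
    using assoc_mult_mat[OF circuit_op_carrier[of n D] circuit_op_carrier[of n C] gate_op_carrier[of n g]]
    by simp
qed

section \<open>Action of CNOT and CZ on basis states\<close>

definition CNOT_map :: "nat \<Rightarrow> nat \<Rightarrow> nat \<Rightarrow> nat" where
  "CNOT_map c t y = (if bit y c then y XOR 2 ^ t else y)"

lemma bit_CNOT_map: "bit (CNOT_map c t y) q \<longleftrightarrow> bit y q \<noteq> (q = t \<and> bit y c)"
  by (auto simp: CNOT_map_def bit_xor_iff bit_exp_iff)

lemma CNOT_map_less: "t < n \<Longrightarrow> y < 2 ^ n \<Longrightarrow> CNOT_map c t y < 2 ^ n"
  by (simp add: CNOT_map_def xor_less_exp)

lemma CNOT_map_CNOT_map: "c \<noteq> t \<Longrightarrow> CNOT_map c t (CNOT_map c t y) = y"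
  by (rule bit_eqI) (auto simp: bit_CNOT_map)

lemma local_index_pair: "local_index [q, r] x = 2 * of_bool (bit x q) + of_bool (bit x r)"
  by (simp add: local_index_def)

lemma gate_op_CNOT:
  assumes "c < n" "t < n" "c \<noteq> t"
  shows "gate_op n (CNOT c t) = monomial_op n (\<lambda>y. 1) (CNOT_map c t)"
proof (rule eq_matI)
  fix x y
  assume "x < dim_row (monomial_op n (\<lambda>y. 1) (CNOT_map c t))"
    and "y < dim_col (monomial_op n (\<lambda>y. 1) (CNOT_map c t))"
  then have xy: "x < 2 ^ n" "y < 2 ^ n" by (auto simp: monomial_op_def)
  have iff: "x = CNOT_map c t y \<longleftrightarrow> (\<forall>q<n. q \<notin> {c, t} \<longrightarrow> bit x q = bit y q) \<and>
      bit x c = bit y c \<and> bit x t = (bit y t \<noteq> bit y c)"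
    using eq_iff_bits[OF xy(1) CNOT_map_less[OF assms(2) xy(2), of c]] assms by (auto simp: bit_CNOT_map)
  show "gate_op n (CNOT c t) $$ (x, y) = monomial_op n (\<lambda>y. 1) (CNOT_map c t) $$ (x, y)"
    using xy by (cases "bit x c"; cases "bit x t"; cases "bit y c"; cases "bit y t")
      (auto simp: gate_op_def embed_op_def monomial_op_def iff local_index_pair mat_of_rows_list_def)
qed (simp_all add: gate_op_def embed_op_def monomial_op_def)

lemma gate_op_CZ:
  assumes "q < n" "r < n" "q \<noteq> r"
  shows "gate_op n (CZ q r) = parity_CZ_op n (\<lambda>s. of_bool (s = q)) (\<lambda>s. of_bool (s = r))"
proof (rule eq_matI)
  fix x y
  assume "x < dim_row (parity_CZ_op n (\<lambda>s. of_bool (s = q)) (\<lambda>s. of_bool (s = r)))"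
    and "y < dim_col (parity_CZ_op n (\<lambda>s. of_bool (s = q)) (\<lambda>s. of_bool (s = r)))"
  then have xy: "x < 2 ^ n" "y < 2 ^ n" by (auto simp: parity_CZ_op_def monomial_op_def)
  have iff: "x = y \<longleftrightarrow> (\<forall>s<n. s \<notin> {q, r} \<longrightarrow> bit x s = bit y s) \<and> bit x q = bit y q \<and> bit x r = bit y r"
    using eq_iff_bits[OF xy] assms by auto
  have parity: "parity_on n (\<lambda>s. of_bool (s = u)) y = of_bool (bit y u)" if "u < n" for u
  proof -
    have "parity_on n (\<lambda>s. of_bool (s = u)) y = (\<Sum>s<n. if s = u then of_bool (bit y s) else 0)"
      unfolding parity_on_def by (intro sum.cong) auto
    then show ?thesis using that by simp
  qed
  show "gate_op n (CZ q r) $$ (x, y) =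
      parity_CZ_op n (\<lambda>s. of_bool (s = q)) (\<lambda>s. of_bool (s = r)) $$ (x, y)"
    using xy assms by (cases "bit x q"; cases "bit x r"; cases "bit y q"; cases "bit y r")
      (auto simp: gate_op_def embed_op_def parity_CZ_op_def monomial_op_def parity iff
        local_index_pair mat_of_rows_list_def)
qed (simp_all add: gate_op_def embed_op_def parity_CZ_op_def monomial_op_def)

text \<open>A linear form is pulled back in the direction opposite to the flip: its coefficient at
  the target is added to the one at the control, as when a CNOT propagates \<open>Z\<close> from
  target to control.\<close>

lemma parity_on_CNOT_map:
  assumes "c < n" "t < n"
  shows "parity_on n z (CNOT_map c t y) = parity_on n (\<lambda>q. z q + of_bool (q = c) * z t) y"
proof -
  have "parity_on n (\<lambda>q. z q + of_bool (q = c) * z t) y =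
      parity_on n z y + (\<Sum>q<n. if q = c then z t * of_bool (bit y q) else 0)"
    unfolding parity_on_def sum.distrib[symmetric]
    by (intro sum.cong) (auto simp: distrib_right)
  then show ?thesis
    using assms by (simp add: CNOT_map_def parity_on_xor parity_on_exp)
qed

text \<open>The two CNOTs are inverse to each other, so the permutations cancel and a diagonal
  operator with pulled-back parities is left.\<close>

lemma circuit_op_conj_CNOT:
  assumes "c < n" "t < n" "c \<noteq> t" and C: "circuit_op n C = parity_CZ_op n z w"
  shows "circuit_op n (CNOT c t # C @ [CNOT c t]) =
    parity_CZ_op n (\<lambda>q. z q + of_bool (q = c) * z t) (\<lambda>q. w q + of_bool (q = c) * w t)"
proof -
  have "circuit_op n (CNOT c t # C @ [CNOT c t]) =
      monomial_op n (\<lambda>y. 1) (CNOT_map c t) * circuit_op n C * monomial_op n (\<lambda>y. 1) (CNOT_map c t)"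
    using left_mult_one_mat[OF monomial_op_carrier] assms by (simp add: circuit_op_append gate_op_CNOT)
  then show ?thesis
    using assms CNOT_map_less[OF assms(2)]
    by (simp add: C parity_CZ_op_def monomial_op_mult CNOT_map_CNOT_map parity_on_CNOT_map)
qed

text \<open>Since \<open>z t = 1\<close> and \<open>w t = 0\<close>, each enclosing CNOT toggles
  \<open>z\<close> at its control and leaves \<open>w\<close> alone. The target is not among the
  controls, so its coefficients keep these values throughout the induction.\<close>

lemma circuit_op_conj_CNOT_fan:
  assumes "t < n" "z t = 1" "w t = 0" "circuit_op n C = parity_CZ_op n z w"
    and "distinct cs" "set cs \<subseteq> {..<n} - {t}"
  shows "circuit_op n (map (\<lambda>c. CNOT c t) cs @ C @ rev (map (\<lambda>c. CNOT c t) cs)) =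
    parity_CZ_op n (\<lambda>q. z q + of_bool (q \<in> set cs)) w"
  using assms(5,6)
proof (induction cs)
  case Nil
  then show ?case using assms by simp
next
  case (Cons c cs)
  define z' where "z' = (\<lambda>q. z q + of_bool (q \<in> set cs))"
  have "circuit_op n (CNOT c t # (map (\<lambda>c. CNOT c t) cs @ C @ rev (map (\<lambda>c. CNOT c t) cs)) @ [CNOT c t]) =
      parity_CZ_op n (\<lambda>q. z' q + of_bool (q = c) * z' t) (\<lambda>q. w q + of_bool (q = c) * w t)"
    using Cons assms(1) by (intro circuit_op_conj_CNOT) (auto simp: z'_def)
  moreover have "z' t = 1" using Cons.prems assms(2) by (auto simp: z'_def)
  moreover have "z' q + of_bool (q = c) = z q + of_bool (q \<in> set (c # cs))" for q
    using Cons.prems by (auto simp: z'_def)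
  ultimately show ?case using assms(3) by simp
qed

text \<open>
  The first fans of CNOTs write the parities onto the pivots \<open>p\<close> and \<open>q\<close>. Neither pivot is a
  control of a fan, as \<open>p\<close> is outside the support of \<open>w\<close> and \<open>q\<close> is outside that of \<open>z\<close>.
\<close>

definition parity_CZ_circuit :: "nat \<Rightarrow> (nat \<Rightarrow> bit) \<Rightarrow> nat \<Rightarrow> (nat \<Rightarrow> bit) \<Rightarrow> nat \<Rightarrow> gate list" where
  "parity_CZ_circuit n z p w q =
    (let F = map (\<lambda>c. CNOT c p) (sorted_list_of_set ({r. r < n \<and> z r = 1} - {p}));
         G = map (\<lambda>c. CNOT c q) (sorted_list_of_set ({r. r < n \<and> w r = 1} - {q}))
     in G @ (F @ [CZ p q] @ rev F) @ rev G)"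

locale parity_pivots =
  fixes n :: nat and z w :: "nat \<Rightarrow> bit" and p q :: nat
  assumes less: "p < n" "q < n" and pivots: "z p = 1" "w p = 0" "w q = 1" "z q = 0"
begin

lemma distinct_pivots: "p \<noteq> q"
  using pivots by auto

lemma circuit_on_parity_CZ_circuit: "circuit_on n (parity_CZ_circuit n z p w q)"
  using less distinct_pivots by (auto simp: circuit_on_def parity_CZ_circuit_def Let_def)

lemma circuit_op_parity_CZ_circuit: "circuit_op n (parity_CZ_circuit n z p w q) = parity_CZ_op n z w"
proof -
  let ?fan = "\<lambda>t u. map (\<lambda>c. CNOT c t) (sorted_list_of_set ({r. r < n \<and> u r = 1} - {t}))"
  have CZ: "circuit_op n [CZ p q] = parity_CZ_op n (\<lambda>s. of_bool (s = p)) (\<lambda>s. of_bool (s = q))"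
    using less distinct_pivots left_mult_one_mat[OF gate_op_carrier] by (simp add: gate_op_CZ[symmetric])
  \<comment> \<open>A fan starts from the unit vector at its pivot and adds the rest of the
    support.\<close>
  have fill: "of_bool (r = t) + of_bool (r \<in> {r. r < n \<and> u r = 1} - {t}) = u r"
    if "u t = 1" "r < n" for u :: "nat \<Rightarrow> bit" and t r
    using that by (cases "u r") auto
  have "circuit_op n (?fan p z @ [CZ p q] @ rev (?fan p z)) =
      parity_CZ_op n (\<lambda>r. of_bool (r = p) + of_bool (r \<in> {r. r < n \<and> z r = 1} - {p})) (\<lambda>r. of_bool (r = q))"
    by (subst circuit_op_conj_CNOT_fan[OF _ _ _ CZ]) (use less distinct_pivots in auto)
  also have "\<dots> = parity_CZ_op n z (\<lambda>r. of_bool (r = q))"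
    by (intro parity_CZ_op_cong fill) (use pivots in auto)
  \<comment> \<open>A fan expands the first of the two forms, so they are exchanged before the fan
    for \<open>w\<close> is added. That fan leaves \<open>z\<close> intact because
    \<open>z q = 0\<close>.\<close>
  finally have inner: "circuit_op n (?fan p z @ [CZ p q] @ rev (?fan p z)) = parity_CZ_op n (\<lambda>r. of_bool (r = q)) z"
    by (simp only: parity_CZ_op_commute)
  have "circuit_op n (parity_CZ_circuit n z p w q) =
      parity_CZ_op n (\<lambda>r. of_bool (r = q) + of_bool (r \<in> {r. r < n \<and> w r = 1} - {q})) z"
    unfolding parity_CZ_circuit_def Let_def
    by (subst circuit_op_conj_CNOT_fan[OF _ _ _ inner]) (use less pivots in auto)
  also have "\<dots> = parity_CZ_op n w z"
    by (intro parity_CZ_op_cong fill) (use pivots in auto)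
  finally show ?thesis by (simp only: parity_CZ_op_commute)
qed

end

section \<open>Depth and support size of the circuit\<close>

lemma layering_length: "layering C (length C) (\<lambda>s. s)"
  by (simp add: layering_def)

lemma circuit_depth_le_length: "circuit_depth C \<le> length C"
  unfolding circuit_depth_def by (rule Least_le) (use layering_length in blast)

text \<open>Gates that share the qubit \<open>q\<close> overlap pairwise, so any arrangement puts
  them into distinct layers.\<close>

lemma length_filter_le_circuit_depth:
  "length (filter (\<lambda>g. q \<in> set (gate_qubits g)) C) \<le> circuit_depth C"
proof -
  have "\<exists>f. layering C (circuit_depth C) f"
    unfolding circuit_depth_def by (rule LeastI_ex) (use layering_length in blast)
  then obtain f where f: "layering C (circuit_depth C) f" by blast
  let ?I = "{s. s < length C \<and> q \<in> set (gate_qubits (C ! s))}"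
  have "inj_on f ?I"
  proof (rule linorder_inj_onI')
    fix s t
    assume "s \<in> ?I" "t \<in> ?I" "s < t"
    then have "f s < f t" using f unfolding layering_def by blast
    then show "f s \<noteq> f t" by simp
  qed
  moreover have "f ` ?I \<subseteq> {..<circuit_depth C}"
    using f by (auto simp: layering_def)
  ultimately have "card ?I \<le> card {..<circuit_depth C}"
    by (intro card_inj_on_le) auto
  then show ?thesis by (simp add: length_filter_conv_card)
qed

context parity_pivots
begin

text \<open>If \<open>z\<close> has weight \<open>a\<close> and \<open>w\<close> has weight
  \<open>b\<close>, the fan for \<open>z\<close> and its inverse have \<open>a - 1\<close> gates
  each, all on qubit \<open>p\<close>, and the CZ gate acts on \<open>p\<close> too. This gives at
  least \<open>2 * a - 1\<close> layers. The upper bound is the total number of gates,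
  \<open>2 * a + 2 * b - 3\<close>.\<close>

lemma circuit_depth_parity_CZ_circuit:
  shows "card {r. r < n \<and> z r = 1} \<le> circuit_depth (parity_CZ_circuit n z p w q)"
    and "circuit_depth (parity_CZ_circuit n z p w q) \<le>
      2 * (card {r. r < n \<and> z r = 1} + card {r. r < n \<and> w r = 1})"
proof -
  let ?Z = "{r. r < n \<and> z r = 1}" and ?W = "{r. r < n \<and> w r = 1}"
  have card: "card ?Z = Suc (card (?Z - {p}))" "card ?W = Suc (card (?W - {q}))"
    using less pivots by (auto simp del: card_Diff_insert intro!: card_Suc_Diff1[symmetric])
  have "card ?Z \<le> length (filter (\<lambda>g. p \<in> set (gate_qubits g)) (parity_CZ_circuit n z p w q))"
    unfolding parity_CZ_circuit_def Let_def card by (simp add: filter_map comp_def flip: rev_filter)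
  then show "card ?Z \<le> circuit_depth (parity_CZ_circuit n z p w q)"
    using length_filter_le_circuit_depth le_trans by blast
  have "length (parity_CZ_circuit n z p w q) \<le> 2 * (card ?Z + card ?W)"
    unfolding parity_CZ_circuit_def Let_def card by simp
  then show "circuit_depth (parity_CZ_circuit n z p w q) \<le> 2 * (card ?Z + card ?W)"
    using circuit_depth_le_length le_trans by blast
qed

lemma support_size_parity_CZ_circuit:
  shows "card {r. r < n \<and> z r = 1} \<le> support_size n (parity_CZ_circuit n z p w q)"
    and "support_size n (parity_CZ_circuit n z p w q) \<le>
      card {r. r < n \<and> z r = 1} + card {r. r < n \<and> w r = 1}"
proof -
  have "op_support n (circuit_op n (parity_CZ_circuit n z p w q)) =
      {r. r < n \<and> z r = 1} \<union> {r. r < n \<and> w r = 1}"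
    using less pivots by (auto simp: circuit_op_parity_CZ_circuit op_support_parity_CZ_op)
  then show "card {r. r < n \<and> z r = 1} \<le> support_size n (parity_CZ_circuit n z p w q)"
    and "support_size n (parity_CZ_circuit n z p w q) \<le>
      card {r. r < n \<and> z r = 1} + card {r. r < n \<and> w r = 1}"
    by (simp_all add: support_size_def card_Un_le card_mono)
qed

end

section \<open>Kronecker products\<close>

text \<open>Quotient and remainder undo the row-major numbering of pairs. Both inner products and
  weights of Kronecker products factor through this.\<close>

lemma sum_div_mod:
  fixes f :: "nat \<Rightarrow> nat \<Rightarrow> 'a::comm_monoid_add"
  shows "(\<Sum>i<m * n. f (i div n) (i mod n)) = (\<Sum>a<m. \<Sum>b<n. f a b)"
proof (cases "n = 0")
  case False
  have "(\<Sum>i<m * n. f (i div n) (i mod n)) = (\<Sum>(a, b)\<in>{..<m} \<times> {..<n}. f a b)"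
  proof (rule sum.reindex_bij_witness[where i = "\<lambda>(a, b). a * n + b" and j = "\<lambda>i. (i div n, i mod n)"])
    fix ab
    assume "ab \<in> {..<m} \<times> {..<n}"
    then obtain a b where ab: "ab = (a, b)" "a < m" "b < n" by auto
    then have "Suc a * n \<le> m * n" by (intro mult_le_mono1) simp
    then show "(case ab of (a, b) \<Rightarrow> a * n + b) \<in> {..<m * n}" using ab by simp
  qed (use False in \<open>auto simp: less_mult_imp_div_less\<close>)
  then show ?thesis by (simp add: sum.cartesian_product)
qed simp

lemma dim_vec_kron_vec [simp]: "dim_vec (kron_vec v w) = dim_vec v * dim_vec w"
  by (simp add: kron_vec_def)

lemma dim_kron_mat [simp]:
  "dim_row (kron_mat A B) = dim_row A * dim_row B" "dim_col (kron_mat A B) = dim_col A * dim_col B"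
  by (simp_all add: kron_mat_def)

lemma dim_append_cols [simp]:
  "dim_row (append_cols A B) = dim_row A" "dim_col (append_cols A B) = dim_col A + dim_col B"
  by (simp_all add: append_cols_def)

lemma scalar_prod_append_dim:
  "dim_vec v = dim_vec v' \<Longrightarrow> dim_vec w = dim_vec w' \<Longrightarrow>
    (v @\<^sub>v w) \<bullet> (v' @\<^sub>v w') = v \<bullet> v' + w \<bullet> w'"
  by (rule scalar_prod_append) (auto intro!: carrier_vecI)

lemma scalar_prod_zero_dim:
  "dim_vec v = n \<Longrightarrow> 0\<^sub>v n \<bullet> v = 0" "dim_vec v = n \<Longrightarrow> v \<bullet> 0\<^sub>v n = 0"
  by (auto simp: scalar_prod_def)

lemma scalar_prod_kron_vec:
  fixes v v' w w' :: "'a::comm_semiring_1 vec"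
  assumes "dim_vec v = dim_vec v'" "dim_vec w = dim_vec w'"
  shows "kron_vec v w \<bullet> kron_vec v' w' = (v \<bullet> v') * (w \<bullet> w')"
proof -
  let ?m = "dim_vec v'" and ?n = "dim_vec w'"
  have "kron_vec v w \<bullet> kron_vec v' w' =
      (\<Sum>i<?m * ?n. (v $ (i div ?n) * v' $ (i div ?n)) * (w $ (i mod ?n) * w' $ (i mod ?n)))"
    using assms by (simp add: scalar_prod_def kron_vec_def lessThan_atLeast0 mult_ac)
  also have "\<dots> = (\<Sum>a<?m. \<Sum>b<?n. (v $ a * v' $ a) * (w $ b * w' $ b))"
    by (rule sum_div_mod)
  also have "\<dots> = (v \<bullet> v') * (w \<bullet> w')"
    by (simp only: scalar_prod_def sum_product lessThan_atLeast0)
  finally show ?thesis .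
qed

lemma row_kron_mat:
  assumes "r < dim_row A * dim_row B"
  shows "row (kron_mat A B) r = kron_vec (row A (r div dim_row B)) (row B (r mod dim_row B))"
proof (rule eq_vecI)
  fix j
  assume "j < dim_vec (kron_vec (row A (r div dim_row B)) (row B (r mod dim_row B)))"
  then have j: "j < dim_col A * dim_col B" by simp
  then have "dim_col B > 0" by (cases "dim_col B") auto
  moreover have "dim_row B > 0" using assms by (cases "dim_row B") auto
  ultimately show "row (kron_mat A B) r $ j = kron_vec (row A (r div dim_row B)) (row B (r mod dim_row B)) $ j"
    using assms j by (simp add: kron_mat_def kron_vec_def less_mult_imp_div_less)
qed simp

lemma row_append_cols:
  assumes "r < dim_row A" "dim_row B = dim_row A"
  shows "row (append_cols A B) r = row A r @\<^sub>v row B r"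
  using assms by (intro eq_vecI) (auto simp: append_cols_def)

lemma kron_vec_index:
  assumes "i < dim_vec v" "j < dim_vec w"
  shows "i * dim_vec w + j < dim_vec v * dim_vec w"
    and "kron_vec v w $ (i * dim_vec w + j) = v $ i * w $ j"
proof -
  have "Suc i * dim_vec w \<le> dim_vec v * dim_vec w"
    using assms by (intro mult_le_mono1) simp
  then show "i * dim_vec w + j < dim_vec v * dim_vec w" using assms by simp
  moreover have "dim_vec w \<noteq> 0" using assms by auto
  ultimately show "kron_vec v w $ (i * dim_vec w + j) = v $ i * w $ j"
    using assms by (simp add: kron_vec_def)
qed

section \<open>The logical operators of a hypergraph product code\<close>

lemma slt_basisD:
  assumes "slt_basis H P v" "i \<in> P"
  shows "i < dim_col H" "v i \<in> carrier_vec (dim_col H)" "H *\<^sub>v v i = 0\<^sub>v (dim_row H)"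
proof -
  interpret kernel "dim_row H" "dim_col H" H by unfold_locales auto
  show "i < dim_col H" using assms by (auto simp: slt_basis_def)
  have "v i \<in> mat_kernel H" using assms by (auto simp: slt_basis_def Ker.basis_def)
  then show "v i \<in> carrier_vec (dim_col H)" "H *\<^sub>v v i = 0\<^sub>v (dim_row H)"
    by (auto simp: mat_kernel_def)
qed

lemma slt_basis_index:
  "slt_basis H P v \<Longrightarrow> i \<in> P \<Longrightarrow> i' \<in> P \<Longrightarrow> v i $ i' = of_bool (i = i')"
  unfolding slt_basis_def by (cases "i = i'") auto

lemma scalar_prod_row_kernel:
  fixes v :: "'a::comm_semiring_0 vec"
  assumes "H *\<^sub>v v = 0\<^sub>v (dim_row H)" "v \<in> carrier_vec (dim_col H)" "r < dim_row H"
  shows "v \<bullet> row H r = 0"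
proof -
  have "row H r \<bullet> v = (H *\<^sub>v v) $ r" using assms(3) by simp
  then show ?thesis
    using assms comm_scalar_prod[OF assms(2) row_carrier_vec[OF assms(3)]] by simp
qed

locale slt_hgp_code =
  fixes Q :: hgp
  assumes slt: "slt_hgp Q"
begin

lemma slt_bases:
  "slt_basis (H_a Q) (piv_a Q) (vec_a Q)" "slt_basis (transpose_mat (H_a Q)) (piv_at Q) (vec_at Q)"
  "slt_basis (H_b Q) (piv_b Q) (vec_b Q)" "slt_basis (transpose_mat (H_b Q)) (piv_bt Q) (vec_bt Q)"
  using slt by (simp_all add: slt_hgp_def)

lemma vec_a:
  assumes "i \<in> piv_a Q"
  shows "i < n_a Q" "dim_vec (vec_a Q i) = n_a Q" "r < m_a Q \<Longrightarrow> vec_a Q i \<bullet> row (H_a Q) r = 0"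
    "i' \<in> piv_a Q \<Longrightarrow> vec_a Q i $ i' = of_bool (i = i')"
  using slt_basisD[OF slt_bases(1) assms] slt_basis_index[OF slt_bases(1) assms] scalar_prod_row_kernel
  by (auto simp: n_a_def m_a_def)

lemma vec_b:
  assumes "h \<in> piv_b Q"
  shows "h < n_b Q" "dim_vec (vec_b Q h) = n_b Q" "h' \<in> piv_b Q \<Longrightarrow> vec_b Q h $ h' = of_bool (h = h')"
  using slt_basisD[OF slt_bases(3) assms] slt_basis_index[OF slt_bases(3) assms] by (auto simp: n_b_def)

lemma vec_at:
  assumes "j \<in> piv_at Q"
  shows "j < m_a Q" "dim_vec (vec_at Q j) = m_a Q" "j' \<in> piv_at Q \<Longrightarrow> vec_at Q j $ j' = of_bool (j = j')"
  using slt_basisD[OF slt_bases(2) assms] slt_basis_index[OF slt_bases(2) assms] by (auto simp: m_a_def)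

lemma vec_bt:
  assumes "l \<in> piv_bt Q"
  shows "l < m_b Q" "dim_vec (vec_bt Q l) = m_b Q"
    "r < n_b Q \<Longrightarrow> vec_bt Q l \<bullet> row (transpose_mat (H_b Q)) r = 0"
    "l' \<in> piv_bt Q \<Longrightarrow> vec_bt Q l $ l' = of_bool (l = l')"
  using slt_basisD[OF slt_bases(4) assms] slt_basis_index[OF slt_bases(4) assms]
    scalar_prod_row_kernel[of "transpose_mat (H_b Q)"]
  by (auto simp: n_b_def m_b_def)

lemmas basis_carrier = vec_a(2)[THEN carrier_vecI] vec_b(2)[THEN carrier_vecI]
  vec_at(2)[THEN carrier_vecI] vec_bt(2)[THEN carrier_vecI]

lemma dim_vec_logical:
  assumes "p \<in> logical_qubits Q"
  shows "dim_vec (logical_X_vec Q p) = num_qubits Q" "dim_vec (logical_Z_vec Q p) = num_qubits Q"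
  using assms vec_a(2) vec_b(2) vec_at(2) vec_bt(2) by (auto simp: logical_qubits_def num_qubits_def)

text \<open>Within a sector the product factors into two coordinates of SLT basis vectors at pivots,
  each a Kronecker delta. Operators of different sectors have disjoint supports.\<close>

lemma logical_Z_X_scalar_prod:
  assumes "p \<in> logical_qubits Q" "r \<in> logical_qubits Q"
  shows "logical_Z_vec Q p \<bullet> logical_X_vec Q r = of_bool (p = r)"
proof -
  have left: "logical_Z_vec Q (LeftQ i h) \<bullet> logical_X_vec Q (LeftQ i' h') = of_bool (i = i' \<and> h = h')"
    if "i \<in> piv_a Q" "i' \<in> piv_a Q" "h \<in> piv_b Q" "h' \<in> piv_b Q" for i i' h h'
    using that by (auto simp: scalar_prod_append_dim scalar_prod_kron_vec vec_a vec_b basis_carrier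
        scalar_prod_left_unit scalar_prod_right_unit)
  have right: "logical_Z_vec Q (RightQ j l) \<bullet> logical_X_vec Q (RightQ j' l') = of_bool (j = j' \<and> l = l')"
    if "j \<in> piv_at Q" "j' \<in> piv_at Q" "l \<in> piv_bt Q" "l' \<in> piv_bt Q" for j j' l l'
    using that by (auto simp: scalar_prod_append_dim scalar_prod_kron_vec vec_at vec_bt basis_carrier
        scalar_prod_left_unit scalar_prod_right_unit)
  have "logical_Z_vec Q (LeftQ i h) \<bullet> logical_X_vec Q (RightQ j l) = 0"
    "logical_Z_vec Q (RightQ j l) \<bullet> logical_X_vec Q (LeftQ i h) = 0"
    if "i \<in> piv_a Q" "h \<in> piv_b Q" "j \<in> piv_at Q" "l \<in> piv_bt Q" for i h j l
    using that by (simp_all add: scalar_prod_append_dim scalar_prod_zero_dim vec_a vec_b vec_at vec_bt)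
  then show ?thesis
    using assms left right by (auto simp: logical_qubits_def)
qed

lemma row_H_X:
  assumes "r < dim_row (H_X Q)"
  shows "row (H_X Q) r = kron_vec (row (H_a Q) (r div n_b Q)) (unit_vec (n_b Q) (r mod n_b Q)) @\<^sub>v
      kron_vec (unit_vec (m_a Q) (r div n_b Q)) (row (transpose_mat (H_b Q)) (r mod n_b Q))"
    and "r div n_b Q < m_a Q" "r mod n_b Q < n_b Q"
proof -
  have r: "r < m_a Q * n_b Q"
    using assms by (simp add: H_X_def m_a_def)
  then show less: "r div n_b Q < m_a Q" "r mod n_b Q < n_b Q"
    by (auto simp: less_mult_imp_div_less intro!: mod_less_divisor gr0I)
  show "row (H_X Q) r = kron_vec (row (H_a Q) (r div n_b Q)) (unit_vec (n_b Q) (r mod n_b Q)) @\<^sub>v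
      kron_vec (unit_vec (m_a Q) (r div n_b Q)) (row (transpose_mat (H_b Q)) (r mod n_b Q))"
    unfolding H_X_def using r less by (simp add: row_append_cols row_kron_mat m_a_def n_b_def)
qed

text \<open>In each sector one Kronecker factor of the product pairs a kernel vector with a row of
  its own check matrix: \<open>a\<^sub>i\<close> with a row of \<open>H\<^sub>a\<close>, or
  \<open>\<beta>\<^sub>l\<close> with a row of the transpose of \<open>H\<^sub>b\<close>.\<close>

lemma logical_Z_row_H_X:
  assumes "p \<in> logical_qubits Q" "r < dim_row (H_X Q)"
  shows "logical_Z_vec Q p \<bullet> row (H_X Q) r = 0"
proof -
  note rX = row_H_X[OF assms(2)]
  have dims: "dim_vec (row (H_a Q) (r div n_b Q)) = n_a Q"
    "dim_vec (row (transpose_mat (H_b Q)) (r mod n_b Q)) = m_b Q"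
    by (simp_all add: n_a_def m_b_def)
  consider i h where "p = LeftQ i h" "i \<in> piv_a Q" "h \<in> piv_b Q"
    | j l where "p = RightQ j l" "j \<in> piv_at Q" "l \<in> piv_bt Q"
    using assms(1) by (auto simp: logical_qubits_def)
  then show ?thesis
  proof cases
    case 1
    then show ?thesis using rX dims
      by (simp add: scalar_prod_append_dim scalar_prod_zero_dim scalar_prod_kron_vec vec_a vec_b del: row_transpose)
  next
    case 2
    then show ?thesis using rX dims
      by (simp add: scalar_prod_append_dim scalar_prod_zero_dim scalar_prod_kron_vec vec_at vec_bt del: row_transpose)
  qed
qed

text \<open>In the conjugation formula both coefficients vanish for a row of \<open>H_X\<close>, and
  they are Kronecker deltas for a logical \<open>X\<close>. \<open>Z\<close>-type operators commute
  with the diagonal unitary.\<close>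

lemma implements_CZ_parity_CZ_op:
  assumes p: "p \<in> logical_qubits Q" and q: "q \<in> logical_qubits Q" and "p \<noteq> q"
    and C: "circuit_op (num_qubits Q) C =
      parity_CZ_op (num_qubits Q) (\<lambda>s. logical_Z_vec Q p $ s) (\<lambda>s. logical_Z_vec Q q $ s)"
  shows "implements_CZ Q p q C"
proof -
  let ?n = "num_qubits Q" and ?z = "logical_Z_vec Q"
  let ?U = "circuit_op ?n C"
  note dims = dim_vec_logical
  \<comment> \<open>All prescribed images are attained exactly, so the phase 1 suffices.\<close>
  have refl: "eq_up_to_phase A A" for A
    unfolding eq_up_to_phase_def by (rule exI[of _ 1]) (auto intro!: eq_matI)
  have X: "conj_by ?U (X_op ?n v) = X_op ?n v * Z_op ?n ((?z p \<bullet> v) \<cdot>\<^sub>v ?z q + (?z q \<bullet> v) \<cdot>\<^sub>v ?z p)"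
    if "dim_vec v = ?n" "?z p \<bullet> v = 0 \<or> ?z q \<bullet> v = 0" for v
    unfolding C using that dims p q by (intro conj_by_parity_CZ_op_X_op) auto
  have Z: "conj_by ?U (Z_op ?n v) = Z_op ?n v" for v
    unfolding C by (rule conj_by_parity_CZ_op_Z_op)
  have Z_op_zero: "X_op ?n v * Z_op ?n (0\<^sub>v ?n) = X_op ?n v" for v
  proof -
    have "parity_on ?n (\<lambda>s. 0\<^sub>v ?n $ s) y = 0" for y
      by (simp add: parity_on_def)
    then show ?thesis by (simp add: X_op_eq Z_op_eq monomial_op_mult)
  qed
  have "conj_by ?U (X_op ?n (row (H_X Q) r)) = X_op ?n (row (H_X Q) r)" if "r < dim_row (H_X Q)" for r
  proof -
    have "dim_vec (row (H_X Q) r) = ?n"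
      by (simp add: H_X_def num_qubits_def n_a_def m_a_def n_b_def m_b_def)
    moreover have "0 \<cdot>\<^sub>v ?z q + 0 \<cdot>\<^sub>v ?z p = 0\<^sub>v ?n"
      by (rule eq_vecI) (use dims p q in auto)
    ultimately show ?thesis
      using X[of "row (H_X Q) r"] logical_Z_row_H_X[OF p that] logical_Z_row_H_X[OF q that]
      by (simp only: Z_op_zero) simp
  qed
  then have stabilizers: "\<forall>S\<in>stabilizer_generators Q. conj_by ?U S = S"
    by (auto simp: stabilizer_generators_def Z)
  have "conj_by ?U (logical_X Q r) =
      (if r = p then logical_X Q p * logical_Z Q q
       else if r = q then logical_Z Q p * logical_X Q q
       else logical_X Q r)" if r: "r \<in> logical_qubits Q" for r
  proof -
    have commute: "logical_X Q q * logical_Z Q p = logical_Z Q p * logical_X Q q"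
      unfolding logical_X_def logical_Z_def
      using p q \<open>p \<noteq> q\<close> by (intro X_op_mult_Z_op_commute) (simp_all add: dims logical_Z_X_scalar_prod)
    have "of_bool (p = r) \<cdot>\<^sub>v ?z q + of_bool (q = r) \<cdot>\<^sub>v ?z p =
        (if r = p then ?z q else if r = q then ?z p else 0\<^sub>v ?n)"
      by (rule eq_vecI) (use dims p q \<open>p \<noteq> q\<close> in auto)
    \<comment> \<open>As \<open>p\<close> and \<open>q\<close> differ, \<open>r\<close> equals at
      most one of them; this is the side condition of the conjugation formula.\<close>
    moreover have "?z p \<bullet> logical_X_vec Q r = 0 \<or> ?z q \<bullet> logical_X_vec Q r = 0"
      using p q r \<open>p \<noteq> q\<close> by (auto simp: logical_Z_X_scalar_prod)
    ultimately have "conj_by ?U (logical_X Q r) =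
        logical_X Q r * Z_op ?n (if r = p then ?z q else if r = q then ?z p else 0\<^sub>v ?n)"
      using X[of "logical_X_vec Q r"] p q r
      by (simp only: logical_X_def logical_Z_X_scalar_prod dims(1))
    then show ?thesis
      using commute by (auto simp: Z_op_zero logical_X_def logical_Z_def)
  qed
  then show ?thesis
    unfolding implements_CZ_def implements_def Let_def
    using stabilizers Z refl by (simp add: logical_Z_def)
qed

text \<open>The physical qubit at the pair of pivots that labels \<open>p\<close>, in the row-major
  numbering of its sector.\<close>

definition pivot_qubit :: "logical_qubit \<Rightarrow> nat" where
  "pivot_qubit p = (case p of LeftQ i h \<Rightarrow> i * n_b Q + h
     | RightQ j l \<Rightarrow> n_a Q * n_b Q + (j * m_b Q + l))"

lemma pivot_qubit_less: "p \<in> logical_qubits Q \<Longrightarrow> pivot_qubit p < num_qubits Q"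
  using kron_vec_index(1)[of _ "unit_vec (n_a Q) 0" _ "unit_vec (n_b Q) 0"]
    kron_vec_index(1)[of _ "unit_vec (m_a Q) 0" _ "unit_vec (m_b Q) 0"] vec_a(1) vec_b(1) vec_at(1) vec_bt(1)
  by (auto simp: logical_qubits_def num_qubits_def pivot_qubit_def intro: trans_less_add1)

text \<open>An entry of a Kronecker product is a product of entries, and the SLT property evaluates
  both at pivots. For distinct qubits this supplies the assumptions of
  \<open>parity_pivots\<close>.\<close>

lemma logical_Z_vec_pivot_qubit:
  assumes "p \<in> logical_qubits Q" "r \<in> logical_qubits Q"
  shows "logical_Z_vec Q p $ pivot_qubit r = of_bool (p = r)"
proof -
  have left_left: "logical_Z_vec Q (LeftQ i h) $ pivot_qubit (LeftQ i' h') = of_bool (i = i' \<and> h = h')"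
    if "i \<in> piv_a Q" "i' \<in> piv_a Q" "h \<in> piv_b Q" "h' \<in> piv_b Q" for i i' h h'
    using kron_vec_index[of i' "vec_a Q i" h' "unit_vec (n_b Q) h"] that vec_a vec_b
    by (auto simp: pivot_qubit_def vec_a(2))
  have right_right: "logical_Z_vec Q (RightQ j l) $ pivot_qubit (RightQ j' l') = of_bool (j = j' \<and> l = l')"
    if "j \<in> piv_at Q" "j' \<in> piv_at Q" "l \<in> piv_bt Q" "l' \<in> piv_bt Q" for j j' l l'
    using kron_vec_index[of j' "unit_vec (m_a Q) j" l' "vec_bt Q l"] that vec_at vec_bt
    by (auto simp: pivot_qubit_def vec_bt(2))
  have left_right: "logical_Z_vec Q (LeftQ i h) $ pivot_qubit (RightQ j l) = 0"
    if "i \<in> piv_a Q" "h \<in> piv_b Q" "j \<in> piv_at Q" "l \<in> piv_bt Q" for i h j l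
    using kron_vec_index(1)[of j "unit_vec (m_a Q) j" l "vec_bt Q l"] that vec_at vec_bt
    by (auto simp: pivot_qubit_def vec_a(2) vec_bt(2))
  have right_left: "logical_Z_vec Q (RightQ j l) $ pivot_qubit (LeftQ i h) = 0"
    if "i \<in> piv_a Q" "h \<in> piv_b Q" "j \<in> piv_at Q" "l \<in> piv_bt Q" for i h j l
    using kron_vec_index(1)[of i "vec_a Q i" h "unit_vec (n_b Q) h"] that vec_a vec_b
    by (auto simp: pivot_qubit_def vec_a(2) vec_bt(2))
  show ?thesis
    using assms left_left right_right left_right right_left by (auto simp: logical_qubits_def)
qed

end

section \<open>Weights and scaling\<close>

text \<open>Written as a sum, the weight of a Kronecker product can be split by
  \<open>sum_div_mod\<close>.\<close>

lemma hamming_weight_sum: "hamming_weight v = (\<Sum>i<dim_vec v. of_bool (v $ i = 1))"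
proof -
  have "{..<dim_vec v} \<inter> {i. v $ i = 1} = {i. i < dim_vec v \<and> v $ i = 1}" by auto
  then show ?thesis by (simp add: hamming_weight_def sum_of_bool_eq)
qed

lemma hamming_weight_kron_vec: "hamming_weight (kron_vec v w) = hamming_weight v * hamming_weight w"
proof -
  have "hamming_weight (kron_vec v w) =
      (\<Sum>i<dim_vec v * dim_vec w. of_bool (v $ (i div dim_vec w) = 1) * of_bool (w $ (i mod dim_vec w) = 1))"
  proof -
    have "(of_bool (a * b = 1) :: nat) = of_bool (a = 1) * of_bool (b = 1)" for a b :: Z2.bit
      by (cases a; cases b) auto
    then show ?thesis by (simp add: hamming_weight_sum kron_vec_def)
  qed
  also have "\<dots> = (\<Sum>a<dim_vec v. \<Sum>b<dim_vec w. of_bool (v $ a = 1) * of_bool (w $ b = 1))"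
    by (rule sum_div_mod)
  finally show ?thesis by (simp only: hamming_weight_sum sum_product)
qed

lemma hamming_weight_append: "hamming_weight (v @\<^sub>v w) = hamming_weight v + hamming_weight w"
proof -
  have "{i. i < dim_vec (v @\<^sub>v w) \<and> (v @\<^sub>v w) $ i = 1} =
      {i. i < dim_vec v \<and> v $ i = 1} \<union> (\<lambda>i. dim_vec v + i) ` {i. i < dim_vec w \<and> w $ i = 1}"
    (is "?L = ?A \<union> ?B")
  proof (rule Set.set_eqI)
    fix i
    show "i \<in> ?L \<longleftrightarrow> i \<in> ?A \<union> ?B"
    proof (cases "i < dim_vec v")
      case False
      then obtain j where "i = dim_vec v + j" by (metis le_Suc_ex not_less)
      then show ?thesis by auto
    qed auto
  qed
  moreover have "card (?A \<union> ?B) = card ?A + card ?B"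
    by (rule card_Un_disjoint) auto
  ultimately show ?thesis
    by (simp add: hamming_weight_def card_image)
qed

lemma hamming_weight_zero_vec [simp]: "hamming_weight (0\<^sub>v n) = 0"
  by (auto simp: hamming_weight_def)

lemma hamming_weight_unit_vec [simp]: "i < n \<Longrightarrow> hamming_weight (unit_vec n i) = 1"
proof -
  assume "i < n"
  then have "{j. j < n \<and> unit_vec n i $ j = (1 :: Z2.bit)} = {i}" by (auto simp: unit_vec_def split: if_splits)
  then show ?thesis by (simp add: hamming_weight_def)
qed

lemma (in slt_hgp_code) hamming_weight_logical_Z_vec:
  shows "i \<in> piv_a Q \<Longrightarrow> h \<in> piv_b Q \<Longrightarrow> hamming_weight (logical_Z_vec Q (LeftQ i h)) = hamming_weight (vec_a Q i)"
    and "j \<in> piv_at Q \<Longrightarrow> l \<in> piv_bt Q \<Longrightarrow> hamming_weight (logical_Z_vec Q (RightQ j l)) = hamming_weight (vec_bt Q l)"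
  using vec_a(1) vec_b(1) vec_at(1) vec_bt(1)
  by (simp_all add: hamming_weight_append hamming_weight_kron_vec)

text \<open>The entry at the pivot is 1. These crude bounds cover the finitely many codes that an
  asymptotic assumption does not control.\<close>

lemma (in slt_hgp_code) hamming_weight_logical_Z_vec_bounds:
  assumes "p \<in> logical_qubits Q"
  shows "1 \<le> hamming_weight (logical_Z_vec Q p)" "hamming_weight (logical_Z_vec Q p) \<le> num_qubits Q"
proof -
  have "{pivot_qubit p} \<subseteq> {i. i < dim_vec (logical_Z_vec Q p) \<and> logical_Z_vec Q p $ i = 1}"
    using assms pivot_qubit_less logical_Z_vec_pivot_qubit dim_vec_logical(2) by simp
  from card_mono[OF _ this] show "1 \<le> hamming_weight (logical_Z_vec Q p)"
    by (simp add: hamming_weight_def)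
  have "{i. i < dim_vec (logical_Z_vec Q p) \<and> logical_Z_vec Q p $ i = 1} \<subseteq> {..<num_qubits Q}"
    using dim_vec_logical(2)[OF assms] by auto
  from card_mono[OF _ this] show "hamming_weight (logical_Z_vec Q p) \<le> num_qubits Q"
    by (simp add: hamming_weight_def)
qed

lemma (in slt_hgp_code) exists_CZ_circuit:
  assumes p: "p \<in> logical_qubits Q" and q: "q \<in> logical_qubits Q" and "p \<noteq> q"
  defines "n \<equiv> num_qubits Q" and "wt \<equiv> (\<lambda>r. hamming_weight (logical_Z_vec Q r))"
  shows "\<exists>C. circuit_on n C \<and> implements_CZ Q p q C \<and>
    wt p \<le> support_size n C \<and> support_size n C \<le> wt p + wt q \<and>
    wt p \<le> circuit_depth C \<and> circuit_depth C \<le> 2 * (wt p + wt q)"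
proof -
  let ?z = "\<lambda>s. logical_Z_vec Q p $ s" and ?w = "\<lambda>s. logical_Z_vec Q q $ s"
  interpret parity_pivots "num_qubits Q" ?z ?w "pivot_qubit p" "pivot_qubit q"
    using p q \<open>p \<noteq> q\<close> by unfold_locales (simp_all add: pivot_qubit_less logical_Z_vec_pivot_qubit)
  have "wt r = card {s. s < num_qubits Q \<and> logical_Z_vec Q r $ s = 1}" if "r \<in> logical_qubits Q" for r
    using dim_vec_logical(2)[OF that] by (simp add: wt_def hamming_weight_def)
  then show ?thesis
    unfolding n_def
    using p q circuit_on_parity_CZ_circuit circuit_depth_parity_CZ_circuit support_size_parity_CZ_circuit
      implements_CZ_parity_CZ_op[OF p q \<open>p \<noteq> q\<close> circuit_op_parity_CZ_circuit]
    by (intro exI[of _ "parity_CZ_circuit (num_qubits Q) ?z (pivot_qubit p) ?w (pivot_qubit q)"]) simp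
qed

text \<open>The scaling assumption speaks of all large \<open>k\<close> only. The finitely many
  remaining codes have bounded length, so adjusting the constants makes the bounds hold for every
  \<open>k\<close>.\<close>

lemma uniform_logical_Z_weight:
  fixes Q :: "nat \<Rightarrow> hgp"
  assumes slt: "\<And>k. slt_hgp (Q k)" and scaling: "hgp_scaling Q"
  obtains c1 c2 where "c1 > 0" "c2 > 0"
    and "\<And>k p. p \<in> logical_qubits (Q k) \<Longrightarrow>
      c1 * sqrt (real (num_qubits (Q k))) \<le> real (hamming_weight (logical_Z_vec (Q k) p)) \<and>
      real (hamming_weight (logical_Z_vec (Q k) p)) \<le> c2 * sqrt (real (num_qubits (Q k)))"
proof -
  define B where "B k = vec_a (Q k) ` piv_a (Q k) \<union> vec_at (Q k) ` piv_at (Q k) \<union>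
    vec_b (Q k) ` piv_b (Q k) \<union> vec_bt (Q k) ` piv_bt (Q k)" for k
  define proportional where "proportional d1 d2 k v \<longleftrightarrow>
    d1 * sqrt (real (num_qubits (Q k))) \<le> real (hamming_weight v) \<and>
    real (hamming_weight v) \<le> d2 * sqrt (real (num_qubits (Q k)))" for d1 d2 k v
  have "\<exists>d1>0. \<exists>d2>0. \<forall>\<^sub>F k in sequentially. \<forall>v\<in>B k. proportional d1 d2 k v"
    using scaling by (simp only: hgp_scaling_def B_def proportional_def)
  then obtain d1 d2 where d: "d1 > 0" "d2 > 0"
    and "\<forall>\<^sub>F k in sequentially. \<forall>v\<in>B k. proportional d1 d2 k v"
    by blast
  then obtain K where K: "\<forall>k\<ge>K. \<forall>v\<in>B k. proportional d1 d2 k v"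
    by (auto simp: eventually_sequentially)
  \<comment> \<open>\<open>M\<close> bounds the lengths of all codes before \<open>K\<close>; the
    successor keeps it positive even if \<open>K = 0\<close>.\<close>
  define M where "M = Suc (\<Sum>k<K. num_qubits (Q k))"
  have M_pos: "M > 0" by (simp add: M_def)
  define c1 where "c1 = min d1 (1 / real M)"
  define c2 where "c2 = max d2 (real M)"
  have "c1 * sqrt (real (num_qubits (Q k))) \<le> real (hamming_weight (logical_Z_vec (Q k) p)) \<and>
      real (hamming_weight (logical_Z_vec (Q k) p)) \<le> c2 * sqrt (real (num_qubits (Q k)))"
    if p: "p \<in> logical_qubits (Q k)" for k p
  proof -
    interpret slt_hgp_code "Q k" by unfold_locales (rule slt)
    let ?n = "real (num_qubits (Q k))" and ?w = "real (hamming_weight (logical_Z_vec (Q k) p))"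
    have w: "1 \<le> ?w" "?w \<le> ?n" using hamming_weight_logical_Z_vec_bounds[OF p] by simp_all
    have "d1 * sqrt ?n \<le> ?w \<and> ?w \<le> d2 * sqrt ?n \<or> 1 / real M * sqrt ?n \<le> ?w \<and> ?w \<le> real M * sqrt ?n"
    proof (cases "k < K")
      case True
      then have "num_qubits (Q k) \<le> (\<Sum>k<K. num_qubits (Q k))"
        by (intro member_le_sum) auto
      then have "num_qubits (Q k) \<le> M" by (simp add: M_def)
      then have M: "?n \<le> real M" by simp
      \<comment> \<open>From \<open>1 \<le> ?w \<le> ?n \<le> M\<close> follow
        \<open>sqrt ?n \<le> ?n \<le> M\<close>, hence \<open>sqrt ?n / M \<le> 1 \<le> ?w\<close>,
        and \<open>?w \<le> M \<le> M * sqrt ?n\<close>.\<close>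
      have sqrt: "1 \<le> sqrt ?n" using w by simp
      then have "sqrt ?n * 1 \<le> sqrt ?n * sqrt ?n" by (intro mult_left_mono) auto
      then have "sqrt ?n \<le> real M" using M by simp
      then have "1 / real M * sqrt ?n \<le> 1" using M_pos by (simp add: divide_simps)
      moreover have "real M * 1 \<le> real M * sqrt ?n" using sqrt by (intro mult_left_mono) auto
      ultimately show ?thesis using w M by linarith
    next
      case False
      \<comment> \<open>The unit vector factor has weight 1, so \<open>v\<close> can be
        \<open>a\<^sub>i\<close> in the left sector and \<open>\<beta>\<^sub>l\<close> in the right
        one.\<close>
      have "\<exists>v\<in>B k. hamming_weight (logical_Z_vec (Q k) p) = hamming_weight v"
        using p hamming_weight_logical_Z_vec
        by (auto simp: logical_qubits_def B_def simp del: logical_Z_vec.simps)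
      then show ?thesis using K False by (auto simp: proportional_def)
    qed
    moreover have "c1 * sqrt ?n \<le> d1 * sqrt ?n" "c1 * sqrt ?n \<le> 1 / real M * sqrt ?n"
      "d2 * sqrt ?n \<le> c2 * sqrt ?n" "real M * sqrt ?n \<le> c2 * sqrt ?n"
      by (intro mult_right_mono; simp add: c1_def c2_def)+
    ultimately show ?thesis by linarith
  qed
  moreover have "c1 > 0" "c2 > 0" using d M_pos by (auto simp: c1_def c2_def)
  ultimately show thesis using that by blast
qed

theorem theorem4p10:
  fixes Q :: "nat \<Rightarrow> hgp"
  assumes slt: "\<And>k. slt_hgp (Q k)"
    and scaling: "hgp_scaling Q"
  shows "(\<exists>c1>0. \<exists>c2>0. \<forall>k.
            \<forall>i1\<in>piv_a (Q k). \<forall>h1\<in>piv_b (Q k). \<forall>i2\<in>piv_a (Q k). \<forall>h2\<in>piv_b (Q k).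
              (i1, h1) \<noteq> (i2, h2) \<longrightarrow>
              (\<exists>C. circuit_on (num_qubits (Q k)) C \<and>
                   implements_CZ (Q k) (LeftQ i1 h1) (LeftQ i2 h2) C \<and>
                   order_sqrt c1 c2 (Q k) C)) \<and>
         (\<exists>c1>0. \<exists>c2>0. \<forall>k.
            \<forall>i\<in>piv_a (Q k). \<forall>h\<in>piv_b (Q k). \<forall>j\<in>piv_at (Q k). \<forall>l\<in>piv_bt (Q k).
              (\<exists>C. circuit_on (num_qubits (Q k)) C \<and>
                   implements_CZ (Q k) (LeftQ i h) (RightQ j l) C \<and>
                   order_sqrt c1 c2 (Q k) C))"
proof -
  obtain c1 c2 where c: "c1 > 0" "c2 > 0"
    and weight: "\<And>k p. p \<in> logical_qubits (Q k) \<Longrightarrow>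
      c1 * sqrt (real (num_qubits (Q k))) \<le> real (hamming_weight (logical_Z_vec (Q k) p)) \<and>
      real (hamming_weight (logical_Z_vec (Q k) p)) \<le> c2 * sqrt (real (num_qubits (Q k)))"
    using uniform_logical_Z_weight[OF slt scaling] by blast
  \<comment> \<open>The factor 4 comes from the depth bound, twice the sum of two weights of at most
    \<open>c2 * sqrt n\<close> each. Both claims are instances, since labels of different sectors
    are always distinct.\<close>
  have circuit: "\<exists>C. circuit_on (num_qubits (Q k)) C \<and> implements_CZ (Q k) p q C \<and>
      order_sqrt c1 (4 * c2) (Q k) C"
    if p: "p \<in> logical_qubits (Q k)" and q: "q \<in> logical_qubits (Q k)" and "p \<noteq> q" for k p q
  proof -
    interpret slt_hgp_code "Q k" by unfold_locales (rule slt)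
    obtain C where C: "circuit_on (num_qubits (Q k)) C" "implements_CZ (Q k) p q C"
      and bounds: "hamming_weight (logical_Z_vec (Q k) p) \<le> support_size (num_qubits (Q k)) C"
        "support_size (num_qubits (Q k)) C \<le>
          hamming_weight (logical_Z_vec (Q k) p) + hamming_weight (logical_Z_vec (Q k) q)"
        "hamming_weight (logical_Z_vec (Q k) p) \<le> circuit_depth C"
        "circuit_depth C \<le>
          2 * (hamming_weight (logical_Z_vec (Q k) p) + hamming_weight (logical_Z_vec (Q k) q))"
      using exists_CZ_circuit[OF p q \<open>p \<noteq> q\<close>] by blast
    have "order_sqrt c1 (4 * c2) (Q k) C"
      unfolding order_sqrt_def Let_def
      using bounds[THEN of_nat_mono[where ?'a = real]] weight[OF p] weight[OF q] by simp
    then show ?thesis using C by blast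
  qed
  have "LeftQ i h \<in> logical_qubits (Q k)" if "i \<in> piv_a (Q k)" "h \<in> piv_b (Q k)" for i h k
    using that by (simp add: logical_qubits_def)
  moreover have "RightQ j l \<in> logical_qubits (Q k)" if "j \<in> piv_at (Q k)" "l \<in> piv_bt (Q k)" for j l k
    using that by (simp add: logical_qubits_def)
  ultimately show ?thesis
    using c by (intro conjI exI[of _ c1] exI[of _ "4 * c2"] allI ballI impI circuit) auto
qed

end
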